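(* For an odd prime power $q$ let $G_q$ be the group of bijections of $\mathbb{F}_q[i]$ (identified with $\mathbb{F}_q^2$) generated by: the translations $x\mapsto x+v$ for all $v\in\mathbb{F}_q[i]$; the reflection $x\mapsto\bar{x}$; the maps $x\mapsto\alpha x$ for all $\alpha\in\mathbb{F}_q[i]$ with $N(\alpha)\in\square_q\setminus\{0\}$; and the maps $a+bi\mapsto\sigma(a)+\sigma(b)i$ ($a,b\in\mathbb{F}_q$) for all field automorphisms $\sigma$ of $\mathbb{F}_q$. Then: (a) $[\operatorname{AffAut}(\mathbb{F}_5^2):G_5]=2$, $|\operatorname{AffAut}(\mathbb{F}_5^2)|=800$ and $|\operatorname{Aut}(\mathbb{F}_5^2)|=28800$. (b) $[\operatorname{AffAut}(\mathbb{F}_9^2):G_9]=3$, $|\operatorname{AffAut}(\mathbb{F}_9^2)|=31104$ and $|\operatorname{Aut}(\mathbb{F}_9^2)|=186624$.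
   Context: Let $q$ be an odd prime power and $\mathbb{F}_q$ the field with $q$ elements. $\square_q$ denotes the set of squares in $\mathbb{F}_q$, including $0$. The affine plane $\mathbb{F}_q^2$ is identified with the ring $\mathbb{F}_q[i]=\mathbb{F}_q[X]/(X^2+1)$, where $i$ is the class of $X$, via $(x,y)\leftrightarrow x+yi$. For $z=x+yi$ with $x,y\in\mathbb{F}_q$, $\bar z=x-yi$ and $N(z)=z\bar z=x^2+y^2$. Points $z,w$ are at integral distance if $N(z-w)\in\square_q$. An integral automorphism is a bijection $\phi:\mathbb{F}_q^2\to\mathbb{F}_q^2$ preserving integral distances, i.e. mapping pairs of points at integral distance to pairs of points at integral distance; the group of these is $\operatorname{Aut}(\mathbb{F}_q^2)$. $\operatorname{AffAut}(\mathbb{F}_q^2)$ is the subgroup of those integral automorphisms that are also automorphisms of the affine plane $\mathbb{F}_q^2$ (they map affine lines to affine lines). *)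

theory Defs
  imports
    "HOL-Algebra.Bij"
    "HOL-Algebra.Coset"
    "HOL-Algebra.Generated_Groups"
    "HOL-Library.Product_Plus"
    "HOL-Library.Cardinality"
    "HOL-Computational_Algebra.Polynomial"
begin

text \<open>
  The field with \<open>q\<close> elements is a type \<open>'a :: {field, finite}\<close> with \<open>CARD('a) = q\<close>. The pair
  \<open>(x, y) :: 'a \<times> 'a\<close> stands both for the point of the affine plane and for the element
  \<open>x + y i\<close> of \<open>F\<^sub>q[i] = F\<^sub>q[X]/(X\<^sup>2 + 1)\<close>. Addition is componentwise (\<^theory>\<open>HOL-Library.Product_Plus\<close>).
\<close>

definition gmult :: "'a::field \<times> 'a \<Rightarrow> 'a \<times> 'a \<Rightarrow> 'a \<times> 'a"  (infixl \<open>\<odot>\<close> 70) where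
  "z \<odot> w = (fst z * fst w - snd z * snd w, fst z * snd w + snd z * fst w)"

text \<open>\<open>\<odot>\<close> is multiplication modulo \<open>X\<^sup>2 + 1\<close> on representatives of degree at most one.\<close>

lemma gmult_eq_poly_mod:
  fixes z w :: "'a::field \<times> 'a"
  shows "[:fst (z \<odot> w), snd (z \<odot> w):] = ([:fst z, snd z:] * [:fst w, snd w:]) mod [:1, 0, 1:]"
proof -
  let ?m = "[:1, 0, 1:] :: 'a poly"
  have "[:fst z, snd z:] * [:fst w, snd w:] = [:fst (z \<odot> w), snd (z \<odot> w):] + [:snd z * snd w:] * ?m"
    by (simp add: gmult_def algebra_simps)
  hence "([:fst z, snd z:] * [:fst w, snd w:]) mod ?m = [:fst (z \<odot> w), snd (z \<odot> w):] mod ?m"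
    by (metis mod_mult_self1)
  also have "\<dots> = [:fst (z \<odot> w), snd (z \<odot> w):]"
    by (rule mod_poly_less) (auto simp: degree_pCons_eq_if)
  finally show ?thesis ..
qed

definition gconj :: "'a::field \<times> 'a \<Rightarrow> 'a \<times> 'a" where
  "gconj z = (fst z, - snd z)"

definition gnorm :: "'a::field \<times> 'a \<Rightarrow> 'a" where
  "gnorm z = (fst z)\<^sup>2 + (snd z)\<^sup>2"

lemma gmult_gconj: "z \<odot> gconj z = (gnorm z, 0)"
  by (simp add: gmult_def gconj_def gnorm_def power2_eq_square)

definition squares :: "'a::field set" where
  "squares = {a. \<exists>b. a = b\<^sup>2}"

definition integral_distance :: "'a::field \<times> 'a \<Rightarrow> 'a \<times> 'a \<Rightarrow> bool" where
  "integral_distance z w \<longleftrightarrow> gnorm (z - w) \<in> squares"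

definition affine_line :: "('a::field \<times> 'a) set \<Rightarrow> bool" where
  "affine_line L \<longleftrightarrow>
    (\<exists>p v. v \<noteq> 0 \<and> L = {(fst p + t * fst v, snd p + t * snd v) | t. True})"

definition field_automorphism :: "('a::field \<Rightarrow> 'a) \<Rightarrow> bool" where
  "field_automorphism \<sigma> \<longleftrightarrow> bij \<sigma> \<and> \<sigma> 1 = 1 \<and>
    (\<forall>a b. \<sigma> (a + b) = \<sigma> a + \<sigma> b) \<and> (\<forall>a b. \<sigma> (a * b) = \<sigma> a * \<sigma> b)"

definition Aut_set :: "('a::field \<times> 'a \<Rightarrow> 'a \<times> 'a) set" where
  "Aut_set = {f. bij f \<and> (\<forall>z w. integral_distance z w \<longrightarrow> integral_distance (f z) (f w))}"

definition AffAut_set :: "('a::field \<times> 'a \<Rightarrow> 'a \<times> 'a) set" where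
  "AffAut_set = {f \<in> Aut_set. \<forall>L. affine_line L \<longrightarrow> affine_line (f ` L)}"

text \<open>Both groups carry composition, i.e. they are subgroups of \<open>BijGroup UNIV\<close> (proved below).\<close>

definition Aut_group :: "('a::field \<times> 'a \<Rightarrow> 'a \<times> 'a) monoid" where
  "Aut_group = (BijGroup UNIV)\<lparr>carrier := Aut_set\<rparr>"

definition AffAut_group :: "('a::field \<times> 'a \<Rightarrow> 'a \<times> 'a) monoid" where
  "AffAut_group = (BijGroup UNIV)\<lparr>carrier := AffAut_set\<rparr>"

definition G_generators :: "('a::field \<times> 'a \<Rightarrow> 'a \<times> 'a) set" where
  "G_generators =
     {\<lambda>z. z + v | v. True} \<union>
     {gconj} \<union>
     {\<lambda>z. \<alpha> \<odot> z | \<alpha>. gnorm \<alpha> \<in> squares - {0}} \<union>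
     {map_prod \<sigma> \<sigma> | \<sigma>. field_automorphism \<sigma>}"

definition G_set :: "('a::field \<times> 'a \<Rightarrow> 'a \<times> 'a) set" where
  "G_set = generate (BijGroup UNIV) G_generators"

definition group_index :: "('g, 'm) monoid_scheme \<Rightarrow> 'g set \<Rightarrow> nat" where
  "group_index K H = card (rcosets\<^bsub>K\<^esub> H)"


text \<open>
  Well-definedness: over every finite field the integral automorphisms and the affine ones form
  groups under composition, and the group generated above is a subgroup of the latter.
\<close>

lemma carrier_BijGroup_UNIV: "carrier (BijGroup UNIV) = {f. bij f}"
  by (simp add: BijGroup_def Bij_def)

lemma mult_BijGroup_UNIV: "bij f \<Longrightarrow> bij g \<Longrightarrow> f \<otimes>\<^bsub>BijGroup UNIV\<^esub> g = f \<circ> g"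
  by (simp add: BijGroup_def Bij_def compose_def fun_eq_iff)

lemma one_BijGroup_UNIV: "\<one>\<^bsub>BijGroup UNIV\<^esub> = id"
  by (simp add: BijGroup_def fun_eq_iff)

lemma inv_BijGroup_UNIV:
  assumes "bij f"
  shows "inv\<^bsub>BijGroup UNIV\<^esub> f = inv_into UNIV f"
proof (rule group.inv_equality[OF group_BijGroup])
  show "inv_into UNIV f \<otimes>\<^bsub>BijGroup UNIV\<^esub> f = \<one>\<^bsub>BijGroup UNIV\<^esub>"
    using assms by (simp add: mult_BijGroup_UNIV one_BijGroup_UNIV bij_imp_bij_inv bij_is_inj)
qed (use assms in \<open>auto simp: carrier_BijGroup_UNIV bij_imp_bij_inv\<close>)

lemma inj_self_map_reflects:
  assumes "finite A" "inj h" "\<And>x. x \<in> A \<Longrightarrow> h x \<in> A" "h y \<in> A"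
  shows "y \<in> A"
proof -
  have "h ` A = A"
    using assms by (intro endo_inj_surj) (auto intro: inj_on_subset)
  with assms(2,4) show ?thesis by (metis imageE injD)
qed

lemma Aut_set_subgroup: "subgroup Aut_set (BijGroup (UNIV :: ('a::{field,finite} \<times> 'a) set))"
proof (rule group.subgroupI[OF group_BijGroup])
  show "Aut_set \<subseteq> carrier (BijGroup (UNIV :: ('a \<times> 'a) set))"
    by (auto simp: Aut_set_def carrier_BijGroup_UNIV)
  have "id \<in> (Aut_set :: ('a \<times> 'a \<Rightarrow> 'a \<times> 'a) set)"
    by (simp add: Aut_set_def)
  thus "(Aut_set :: ('a \<times> 'a \<Rightarrow> 'a \<times> 'a) set) \<noteq> {}" by blast
next
  fix f :: "'a \<times> 'a \<Rightarrow> 'a \<times> 'a" assume f: "f \<in> Aut_set"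
  hence bij: "bij f" by (simp add: Aut_set_def)
  let ?R = "{(z, w). integral_distance z w} :: (('a \<times> 'a) \<times> ('a \<times> 'a)) set"
  have "integral_distance (inv_into UNIV f z) (inv_into UNIV f w)"
    if "integral_distance z w" for z w
  proof -
    have "(inv_into UNIV f z, inv_into UNIV f w) \<in> ?R"
    proof (rule inj_self_map_reflects[where h = "map_prod f f"])
      show "inj (map_prod f f)" using bij by (simp add: bij_is_inj prod.inj_map)
      show "map_prod f f x \<in> ?R" if "x \<in> ?R" for x
        using that f by (cases x) (force simp: Aut_set_def)
      show "map_prod f f (inv_into UNIV f z, inv_into UNIV f w) \<in> ?R"
        using that bij by (simp add: bij_is_surj surj_f_inv_f)
    qed simp
    thus ?thesis by simp
  qed
  thus "inv\<^bsub>BijGroup UNIV\<^esub> f \<in> Aut_set"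
    using bij by (simp add: inv_BijGroup_UNIV Aut_set_def bij_imp_bij_inv)
next
  fix f g :: "'a \<times> 'a \<Rightarrow> 'a \<times> 'a" assume "f \<in> Aut_set" "g \<in> Aut_set"
  thus "f \<otimes>\<^bsub>BijGroup UNIV\<^esub> g \<in> Aut_set"
    by (simp add: Aut_set_def mult_BijGroup_UNIV bij_comp del: split_paired_All)
qed

lemma AffAut_set_subgroup:
  "subgroup AffAut_set (BijGroup (UNIV :: ('a::{field,finite} \<times> 'a) set))"
proof (rule group.subgroupI[OF group_BijGroup])
  show "AffAut_set \<subseteq> carrier (BijGroup (UNIV :: ('a \<times> 'a) set))"
    by (auto simp: AffAut_set_def Aut_set_def carrier_BijGroup_UNIV)
  have "id \<in> (AffAut_set :: ('a \<times> 'a \<Rightarrow> 'a \<times> 'a) set)"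
    by (simp add: AffAut_set_def Aut_set_def)
  thus "(AffAut_set :: ('a \<times> 'a \<Rightarrow> 'a \<times> 'a) set) \<noteq> {}" by blast
next
  fix f :: "'a \<times> 'a \<Rightarrow> 'a \<times> 'a" assume f: "f \<in> AffAut_set"
  hence bij: "bij f" by (simp add: AffAut_set_def Aut_set_def)
  have "affine_line (inv_into UNIV f ` L)" if "affine_line L" for L
  proof -
    have "inv_into UNIV f ` L \<in> Collect affine_line"
    proof (rule inj_self_map_reflects[where h = "image f"])
      show "inj (image f)" using bij by (auto simp: bij_is_inj inj_image_eq_iff intro: injI)
      show "f ` x \<in> Collect affine_line" if "x \<in> Collect affine_line" for x
        using that f by (auto simp: AffAut_set_def)
      show "f ` inv_into UNIV f ` L \<in> Collect affine_line"
        using that bij by (simp add: bij_is_surj image_f_inv_f)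
    qed simp
    thus ?thesis by simp
  qed
  moreover have "inv\<^bsub>BijGroup UNIV\<^esub> f \<in> Aut_set"
    using f by (intro subgroup.m_inv_closed[OF Aut_set_subgroup]) (simp add: AffAut_set_def)
  ultimately show "inv\<^bsub>BijGroup UNIV\<^esub> f \<in> AffAut_set"
    using bij by (simp add: inv_BijGroup_UNIV AffAut_set_def)
next
  fix f g :: "'a \<times> 'a \<Rightarrow> 'a \<times> 'a" assume fg: "f \<in> AffAut_set" "g \<in> AffAut_set"
  hence "f \<otimes>\<^bsub>BijGroup UNIV\<^esub> g \<in> Aut_set"
    by (intro subgroup.m_closed[OF Aut_set_subgroup]) (simp_all add: AffAut_set_def)
  moreover have "f \<otimes>\<^bsub>BijGroup UNIV\<^esub> g = f \<circ> g"
    using fg by (simp add: AffAut_set_def Aut_set_def mult_BijGroup_UNIV)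
  ultimately show "f \<otimes>\<^bsub>BijGroup UNIV\<^esub> g \<in> AffAut_set"
    using fg by (simp add: AffAut_set_def image_comp [symmetric] del: image_image comp_apply)
qed

lemma group_Aut_group: "group (Aut_group :: ('a::{field,finite} \<times> 'a \<Rightarrow> 'a \<times> 'a) monoid)"
  unfolding Aut_group_def
  by (rule subgroup.subgroup_is_group[OF Aut_set_subgroup group_BijGroup])

lemma group_AffAut_group: "group (AffAut_group :: ('a::{field,finite} \<times> 'a \<Rightarrow> 'a \<times> 'a) monoid)"
  unfolding AffAut_group_def
  by (rule subgroup.subgroup_is_group[OF AffAut_set_subgroup group_BijGroup])

lemma affine_line_imageI:
  assumes "affine_line L" "\<And>v. v \<noteq> 0 \<Longrightarrow> h v \<noteq> 0" "surj \<tau>"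
    "\<And>p v t. f (fst p + t * fst v, snd p + t * snd v) =
       (fst (f p) + \<tau> t * fst (h v), snd (f p) + \<tau> t * snd (h v))"
  shows "affine_line (f ` L)"
proof -
  obtain p v where v: "v \<noteq> 0" and L: "L = {(fst p + t * fst v, snd p + t * snd v) | t. True}"
    using assms(1) by (auto simp: affine_line_def)
  have "f ` L = (\<lambda>t. (fst (f p) + \<tau> t * fst (h v), snd (f p) + \<tau> t * snd (h v))) ` UNIV"
    unfolding L full_SetCompr_eq[symmetric] image_Collect assms(4)[symmetric] by blast
  also have "\<dots> = (\<lambda>s. (fst (f p) + s * fst (h v), snd (f p) + s * snd (h v))) ` range \<tau>"
    by (simp add: image_image)
  also have "\<dots> = {(fst (f p) + s * fst (h v), snd (f p) + s * snd (h v)) | s. True}"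
    using assms(3) by auto
  finally show ?thesis
    using assms(2)[OF v] unfolding affine_line_def by blast
qed

lemma gnorm_gmult: "gnorm (z \<odot> w) = gnorm z * gnorm w"
  by (simp add: gnorm_def gmult_def power2_eq_square algebra_simps)

lemma squares_mult: "a \<in> squares \<Longrightarrow> b \<in> squares \<Longrightarrow> a * b \<in> squares"
  by (auto simp: squares_def) (metis power_mult_distrib)

lemma gmult_eq_0D:
  assumes "gnorm \<alpha> \<noteq> 0" "\<alpha> \<odot> z = 0"
  shows "z = 0"
proof -
  have "gconj \<alpha> \<odot> (\<alpha> \<odot> z) = (gnorm \<alpha> * fst z, gnorm \<alpha> * snd z)"
    by (simp add: gmult_def gconj_def gnorm_def power2_eq_square algebra_simps)
  moreover have "gconj \<alpha> \<odot> (\<alpha> \<odot> z) = 0"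
    by (simp add: assms(2)) (simp add: gmult_def zero_prod_def)
  ultimately show ?thesis
    using assms(1) by (simp add: zero_prod_def prod_eq_iff)
qed

lemma G_generators_AffAut: "(G_generators :: ('a::{field,finite} \<times> 'a \<Rightarrow> 'a \<times> 'a) set) \<subseteq> AffAut_set"
proof
  fix f :: "'a \<times> 'a \<Rightarrow> 'a \<times> 'a" assume "f \<in> G_generators"
  then consider (trans) v where "f = (\<lambda>z. z + v)" | (conj) "f = gconj"
    | (mult) \<alpha> where "f = (\<lambda>z. \<alpha> \<odot> z)" "gnorm \<alpha> \<in> squares" "gnorm \<alpha> \<noteq> 0"
    | (frob) \<sigma> where "f = map_prod \<sigma> \<sigma>" "field_automorphism \<sigma>"
    by (auto simp: G_generators_def)
  thus "f \<in> AffAut_set"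
  proof cases
    case trans
    have "bij f" unfolding trans by (rule bij_betw_byWitness[where f' = "\<lambda>z. z - v"]) auto
    moreover have "affine_line (f ` L)" if "affine_line L" for L
      by (rule affine_line_imageI[OF that, where h = id and \<tau> = id])
         (auto simp: trans plus_prod_def)
    ultimately show ?thesis
      by (auto simp: AffAut_set_def Aut_set_def trans integral_distance_def)
  next
    case conj
    have "bij f" unfolding conj by (rule bij_betw_byWitness[where f' = gconj]) (auto simp: gconj_def)
    moreover have "affine_line (f ` L)" if "affine_line L" for L
      by (rule affine_line_imageI[OF that, where h = gconj and \<tau> = id])
         (auto simp: conj gconj_def zero_prod_def prod_eq_iff)
    moreover have "gnorm (gconj z - gconj w) = gnorm (z - w)" for z w :: "'a \<times> 'a"
      by (simp add: gnorm_def gconj_def power2_eq_square algebra_simps)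
    ultimately show ?thesis
      by (auto simp: AffAut_set_def Aut_set_def conj integral_distance_def)
  next
    case mult
    have diff: "\<alpha> \<odot> z - \<alpha> \<odot> w = \<alpha> \<odot> (z - w)" for z w
      by (simp add: gmult_def prod_eq_iff algebra_simps)
    have "inj f"
    proof (rule injI)
      fix z w assume "f z = f w"
      hence "\<alpha> \<odot> (z - w) = 0" by (simp add: mult(1) flip: diff)
      from gmult_eq_0D[OF mult(3) this] show "z = w" by simp
    qed
    hence "bij f" by (simp add: bij_def finite_UNIV_inj_surj)
    moreover have "affine_line (f ` L)" if "affine_line L" for L
    proof (rule affine_line_imageI[OF that, where h = f and \<tau> = id])
      show "f v \<noteq> 0" if "v \<noteq> 0" for v
        using gmult_eq_0D[OF mult(3), of v] that unfolding mult(1) by blast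
    qed (simp_all add: mult(1) gmult_def algebra_simps)
    ultimately show ?thesis
      using mult(2)
      by (auto simp: AffAut_set_def Aut_set_def mult(1) integral_distance_def diff gnorm_gmult
               intro: squares_mult)
  next
    case frob
    from frob(2) have bij: "bij \<sigma>" and add: "\<sigma> (a + b) = \<sigma> a + \<sigma> b"
      and mul: "\<sigma> (a * b) = \<sigma> a * \<sigma> b" for a b
      by (auto simp: field_automorphism_def)
    have zero: "\<sigma> 0 = 0" using add[of 0 0] by (simp only: add_0_right add_cancel_right_right)
    have diff: "\<sigma> (a - b) = \<sigma> a - \<sigma> b" for a b
      using add[of "a - b" b] by (simp add: algebra_simps)
    have "\<sigma> a = 0 \<longleftrightarrow> a = 0" for a
      using bij zero by (metis bij_is_inj injD)
    hence "map_prod \<sigma> \<sigma> v \<noteq> 0" if "v \<noteq> 0" for v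
      using that by (cases v) (simp add: zero_prod_def)
    hence "affine_line (f ` L)" if "affine_line L" for L
      by (intro affine_line_imageI[OF that, where h = "map_prod \<sigma> \<sigma>" and \<tau> = \<sigma>])
         (simp_all add: frob(1) add mul bij bij_is_surj)
    moreover have "bij f"
      unfolding frob(1) using bij by (simp add: bij_def prod.inj_map map_prod_surj)
    moreover have "gnorm (map_prod \<sigma> \<sigma> z - map_prod \<sigma> \<sigma> w) = \<sigma> (gnorm (z - w))" for z w
      by (cases z; cases w) (simp add: gnorm_def power2_eq_square add mul diff)
    moreover have "\<sigma> a \<in> squares" if "a \<in> squares" for a
      using that by (auto simp: squares_def power2_eq_square mul)
    ultimately show ?thesis
      by (auto simp: AffAut_set_def Aut_set_def frob(1) integral_distance_def)
  qed
qed

lemma G_set_subgroup: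
  "subgroup (G_set :: ('a::{field,finite} \<times> 'a \<Rightarrow> 'a \<times> 'a) set) AffAut_group"
proof -
  interpret B: group "BijGroup (UNIV :: ('a \<times> 'a) set)" by (rule group_BijGroup)
  note AffAut_set_subgroup[where 'a = 'a, THEN subgroup.subset]
  with G_generators_AffAut have "subgroup (G_set :: ('a \<times> 'a \<Rightarrow> 'a \<times> 'a) set) (BijGroup UNIV)"
    unfolding G_set_def by (intro B.generate_is_subgroup) blast
  moreover have "(G_set :: ('a \<times> 'a \<Rightarrow> 'a \<times> 'a) set) \<subseteq> AffAut_set"
    unfolding G_set_def
    by (rule B.generate_subgroup_incl[OF G_generators_AffAut AffAut_set_subgroup])
  ultimately show ?thesis
    unfolding AffAut_group_def by (intro B.subgroup_incl AffAut_set_subgroup)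
qed

end

theory Submission
  imports Defs "HOL-Combinatorics.Permutations"
begin

text \<open>
  In suitable linear coordinates \<open>(s, t)\<close> two points are at non-integral distance iff their difference
  lies in a simple set \<open>D\<close>. For \<open>q = 5\<close> this is the union of the two punctured axes, so the
  non-integral distance graph is the 5 by 5 rook graph, whose automorphisms are pairs of permutations of
  rows and columns, possibly followed by the swap. For \<open>q = 9\<close> the set \<open>D\<close> consists of the non-zero
  pairs \<open>(x k, x l)\<close> with \<open>k, l\<close> in the prime field \<open>F\<^sub>3\<close>; identifying \<open>F\<^sub>9\<^sup>2\<close> with the 2 by 2 matrices
  over \<open>F\<^sub>3\<close> these are the matrices of rank one. An automorphism of this graph is determined by the images
  of \<open>0\<close> and of the matrix units \<open>E\<^sub>1\<^sub>1, E\<^sub>2\<^sub>2, E\<^sub>1\<^sub>2\<close>, and every admissible choice of these images is realised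
  by a map \<open>X \<mapsto> P X Q + B\<close> or \<open>X \<mapsto> P X\<^sup>T Q + B\<close>, which leaves \<open>81 \<cdot> 32 \<cdot> 18 \<cdot> 4\<close> possibilities.

  By the fundamental theorem of affine geometry, affine automorphisms are semilinear up to translation, so
  their number is \<open>q\<^sup>2\<close> times the number of linear maps preserving \<open>D\<close> times the number of field
  automorphisms. The index then follows from an explicit parametrisation of \<open>G\<^sub>q\<close> and Lagrange's theorem.
\<close>

section \<open>Line-preserving bijections of the affine plane\<close>

text \<open>The obstacle for q = 9 is that the graph shows only whether the determinant of a
  difference vanishes, while this quadratic form over F_3 has two non-zero values that adjacency
  does not separate. Testing a point y against both e and -e compares \<open>wronski y\<close> with
  plus and minus the polar value of y and e. For anisotropic y this recovers all polar values with a
  frame up to one common sign, and evenness of the form excludes the wrong sign. Such tests need -e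
  to be fixed along with e, although negation is not visibly a graph notion; this is why the third
  point of an F_3-line is first characterised by adjacency. The orders behind the indices are
  products over independent parameters: the affine groups have 25 * 32 * 1 = 800 and 81 * 192 * 2 =
  31104 elements, the generated groups 25 * 8 * 2 * 1 = 400 and 81 * 32 * 2 * 2 = 10368, where 8 and
  32 count the multipliers whose norm is a non-zero square.\<close>

definition scl :: "'a::field \<Rightarrow> 'a \<times> 'a \<Rightarrow> 'a \<times> 'a" where
  "scl x z = (x * fst z, x * snd z)"

definition lin :: "'a::field \<times> 'a \<Rightarrow> 'a \<times> 'a \<Rightarrow> 'a \<times> 'a \<Rightarrow> 'a \<times> 'a" where
  "lin u v z = scl (fst z) u + scl (snd z) v"

definition det2 :: "'a::field \<times> 'a \<Rightarrow> 'a \<times> 'a \<Rightarrow> 'a" where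
  "det2 u v = fst u * snd v - snd u * fst v"

definition line :: "'a::field \<times> 'a \<Rightarrow> 'a \<times> 'a \<Rightarrow> ('a \<times> 'a) set" where
  "line p v = range (\<lambda>t. p + scl t v)"

definition line_preserving :: "('a::field \<times> 'a \<Rightarrow> 'a \<times> 'a) \<Rightarrow> bool" where
  "line_preserving f \<longleftrightarrow> (\<forall>L. affine_line L \<longrightarrow> affine_line (f ` L))"

lemma affine_line_iff: "affine_line L \<longleftrightarrow> (\<exists>p v. v \<noteq> 0 \<and> L = line p v)"
  by (simp add: affine_line_def line_def scl_def full_SetCompr_eq plus_prod_def)

lemma line_base: "p \<in> line p v"
  unfolding line_def by (rule range_eqI[of _ _ 0]) (simp add: scl_def zero_prod_def plus_prod_def)

lemma line_mem: "p + scl t v \<in> line p v"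
  by (simp add: line_def)

text \<open>Turns incidence into a polynomial equation, so that arguments about lines become
  computations with \<open>det2\<close>. The parameter of \<open>z\<close> is found by dividing by a
  non-zero coordinate of \<open>v\<close>.\<close>

lemma mem_line_iff:
  assumes "v \<noteq> 0" shows "z \<in> line p v \<longleftrightarrow> det2 (z - p) v = 0"
proof
  assume "z \<in> line p v" thus "det2 (z - p) v = 0"
    by (auto simp: line_def scl_def det2_def)
next
  assume d: "det2 (z - p) v = 0"
  from assms have "fst v \<noteq> 0 \<or> snd v \<noteq> 0" by (simp add: zero_prod_def prod_eq_iff)
  thus "z \<in> line p v"
  proof
    assume "fst v \<noteq> 0"
    hence "z = p + scl ((fst z - fst p) / fst v) v"
      using d by (simp add: prod_eq_iff scl_def det2_def field_simps)
    thus ?thesis using line_mem by metis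
  next
    assume "snd v \<noteq> 0"
    hence "z = p + scl ((snd z - snd p) / snd v) v"
      using d by (simp add: prod_eq_iff scl_def det2_def field_simps)
    thus ?thesis using line_mem by metis
  qed
qed

lemma det2_diff: "det2 (u - w) v = det2 u v - det2 w v"
  by (simp add: det2_def algebra_simps)

lemma det2_self: "det2 v v = 0"
  by (simp add: det2_def)

lemma det2_commute: "det2 v u = - det2 u v"
  by (simp add: det2_def)

lemma det2_eq_0_trans:
  assumes "v \<noteq> 0" "det2 u v = 0" "det2 w v = 0" shows "det2 u w = 0"
proof -
  from assms(1) have "fst v \<noteq> 0 \<or> snd v \<noteq> 0" by (simp add: zero_prod_def prod_eq_iff)
  \<comment> \<open>Both products are combinations of the two hypotheses; a non-zero coordinate of
    \<open>v\<close> then cancels.\<close>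
  moreover have "fst v * det2 u w = 0" "snd v * det2 u w = 0"
    using assms(2,3) unfolding det2_def by algebra+
  ultimately show ?thesis by auto
qed

lemma line_eq:
  assumes "v \<noteq> 0" "w \<noteq> 0" "q \<in> line p v" "det2 w v = 0"
  shows "line q w = line p v"
proof -
  have q: "det2 (q - p) v = 0" using assms by (simp add: mem_line_iff)
  have "det2 (z - q) w = 0 \<longleftrightarrow> det2 (z - p) v = 0" for z
  proof
    assume "det2 (z - q) w = 0"
    hence "det2 (z - q) v = 0"
      using det2_eq_0_trans[OF assms(2), of "z - q" v] assms(4) by (simp add: det2_commute[of v w])
    thus "det2 (z - p) v = 0" using q by (simp add: det2_diff)
  next
    assume "det2 (z - p) v = 0"
    hence "det2 (z - q) v = 0" using q by (simp add: det2_diff)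
    thus "det2 (z - q) w = 0" using det2_eq_0_trans[OF assms(1)] assms(4) by blast
  qed
  thus ?thesis using assms by (auto simp: mem_line_iff)
qed

lemma affine_line_through:
  assumes "affine_line L" "p \<in> L" "q \<in> L" "p \<noteq> q"
  shows "L = line p (q - p)"
proof -
  obtain r v where v: "v \<noteq> 0" "L = line r v" using assms(1) by (auto simp: affine_line_iff)
  have "det2 (q - p) v = 0"
    using assms(2,3) v by (simp add: mem_line_iff det2_diff)
  thus ?thesis using line_eq[of v "q - p" p r] assms v by simp
qed

lemma disjoint_lines_parallel:
  assumes "line p v \<inter> line q w = {}" shows "det2 w v = 0"
proof (rule ccontr)
  assume d: "det2 w v \<noteq> 0"
  \<comment> \<open>Cramer's rule for the intersection point
    \<open>p + scl t v = q + scl s w\<close>.\<close>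
  define t where "t = det2 (q - p) w / det2 v w"
  define s where "s = det2 (q - p) v / det2 v w"
  have d': "det2 v w \<noteq> 0" using d by (auto simp: det2_def algebra_simps)
  have "det2 v w * (fst p + t * fst v) = det2 v w * (fst q + s * fst w)"
    "det2 v w * (snd p + t * snd v) = det2 v w * (snd q + s * snd w)"
    using d' by (simp_all add: t_def s_def ring_distribs) (simp_all add: det2_def algebra_simps)
  hence "p + scl t v = q + scl s w"
    using d' by (simp add: prod_eq_iff scl_def)
  thus False using assms line_mem by (metis disjoint_iff)
qed

lemma line_preservingD: "line_preserving f \<Longrightarrow> v \<noteq> 0 \<Longrightarrow> affine_line (f ` line p v)"
  unfolding line_preserving_def affine_line_iff by blast

lemma line_preserving_through:
  assumes "line_preserving f" "bij f" "v \<noteq> 0"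
  shows "f ` line p v = line (f p) (f (p + v) - f p)"
proof (rule affine_line_through)
  show "affine_line (f ` line p v)" using assms by (intro line_preservingD)
  show "f p \<in> f ` line p v" by (intro imageI line_base)
  have "p + v = p + scl 1 v" by (simp add: scl_def prod_eq_iff)
  thus "f (p + v) \<in> f ` line p v" by (metis imageI line_mem)
  show "f p \<noteq> f (p + v)" using assms by (auto simp: bij_is_inj inj_eq)
qed

text \<open>Distinct parallel lines are disjoint, a bijection keeps them disjoint, and disjoint
  lines of the plane are parallel. So a parallel class is mapped into a parallel class.\<close>

lemma line_preserving_parallel:
  assumes "bij f" "line_preserving f" "v \<noteq> 0" "v' \<noteq> 0" "f ` line p v = line p' v'"
  shows "f ` line q v = line (f q) v'"
proof (cases "q \<in> line p v")
  case True
  hence "line q v = line p v" using assms(3) by (intro line_eq) (simp_all add: det2_self)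
  moreover have "line (f q) v' = line p' v'"
    using True assms by (intro line_eq) (auto simp: det2_self)
  ultimately show ?thesis using assms by simp
next
  case False
  obtain r w where w: "w \<noteq> 0" "f ` line q v = line r w"
    using line_preservingD[OF assms(2,3)] unfolding affine_line_iff by blast
  have "line p v \<inter> line q v = {}"
  proof (rule ccontr)
    assume "line p v \<inter> line q v \<noteq> {}"
    then obtain z where "det2 (z - p) v = 0" "det2 (z - q) v = 0"
      using assms(3) by (auto simp: mem_line_iff)
    hence "det2 (q - p) v = 0" by (simp add: det2_diff)
    thus False using False assms(3) by (simp add: mem_line_iff)
  qed
  hence "f ` line p v \<inter> f ` line q v = {}"
    using assms(1) by (metis bij_is_inj image_Int image_empty)
  hence "det2 w v' = 0"
    using disjoint_lines_parallel[of p' v' r w] assms(5) w by simp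
  moreover have "f q \<in> line r w" using w line_base by blast
  ultimately have "line (f q) v' = line r w"
    using w assms(4) by (intro line_eq) (simp_all add: det2_commute[of v' w])
  thus ?thesis using w by simp
qed

text \<open>With the frame fixed, the parallel class of \<open>v\<close> goes to that of
  \<open>f v\<close>. Each property of the coordinate map comes from one family of lines:
  horizontals and verticals separate the coordinates, the diagonal identifies the two coordinate
  maps, the lines y = m x give products and the lines y = x + b give sums.\<close>

lemma line_preserving_fixing_frame:
  fixes f :: "'a::field \<times> 'a \<Rightarrow> 'a \<times> 'a"
  assumes bij: "bij f" and pres: "line_preserving f"
    and fix0: "f (0, 0) = (0, 0)" and fix1: "f (1, 0) = (1, 0)" and fix2: "f (0, 1) = (0, 1)"
  obtains \<sigma> where "field_automorphism \<sigma>" "f = map_prod \<sigma> \<sigma>"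
proof -
  have through: "f ` line (0,0) v = line (0,0) (f v)" if "v \<noteq> 0" for v
    using line_preserving_through[OF pres bij that, of "(0,0)"] fix0
    by (simp flip: zero_prod_def)
  have parallel: "f ` line q v = line (f q) (f v)" if "v \<noteq> 0" for q v
  proof -
    have "f v \<noteq> 0" using that fix0 bij by (metis bij_is_inj injD zero_prod_def)
    thus ?thesis using line_preserving_parallel[OF bij pres that _ through[OF that]] by simp
  qed
  have dir: "det2 (f (q + scl t v) - f q) (f v) = 0" if "v \<noteq> 0" for q v t
  proof -
    have "f v \<noteq> 0" using that fix0 bij by (metis bij_is_inj injD zero_prod_def)
    moreover have "f (q + scl t v) \<in> line (f q) (f v)"
      using parallel[OF that, of q] line_mem by blast
    ultimately show ?thesis by (simp add: mem_line_iff)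
  qed
  define \<sigma> where "\<sigma> x = fst (f (x, 0))" for x
  define \<tau> where "\<tau> y = snd (f (0, y))" for y
  have f: "f (x, y) = (\<sigma> x, \<tau> y)" for x y
    using dir[of "(1,0)" "(0,y)" x] dir[of "(0,1)" "(x,0)" y]
    by (simp add: fix1 fix2 \<sigma>_def \<tau>_def zero_prod_def scl_def det2_def prod_eq_iff)
  have \<sigma>0: "\<sigma> 0 = 0" and \<tau>0: "\<tau> 0 = 0" and \<sigma>1: "\<sigma> 1 = 1" and \<tau>1: "\<tau> 1 = 1"
    using fix0 fix1 fix2 f by simp_all
  have \<tau>: "\<tau> x = \<sigma> x" for x
    using dir[of "(1,1)" "(0,0)" x]
    by (simp add: f \<sigma>0 \<tau>0 \<sigma>1 \<tau>1 zero_prod_def scl_def det2_def)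
  have mult: "\<sigma> (m * x) = \<sigma> m * \<sigma> x" for m x
    using dir[of "(1,m)" "(0,0)" x]
    by (simp add: f \<tau> \<sigma>0 \<sigma>1 zero_prod_def scl_def det2_def algebra_simps)
  have add: "\<sigma> (x + b) = \<sigma> x + \<sigma> b" for x b
    using dir[of "(1,1)" "(0,b)" x]
    by (simp add: f \<tau> \<sigma>0 \<sigma>1 zero_prod_def scl_def det2_def algebra_simps)
  have "bij \<sigma>"
  proof (rule bijI)
    show "inj \<sigma>"
      using bij by (intro injI) (metis f \<tau> bij_is_inj injD prod.inject)
    show "surj \<sigma>"
    proof (rule surjI)
      fix y show "\<sigma> (fst (inv_into UNIV f (y, y))) = y"
        using f[of "fst (inv_into UNIV f (y,y))" "snd (inv_into UNIV f (y,y))"] bij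
        by (simp add: bij_is_surj surj_f_inv_f)
    qed
  qed
  hence "field_automorphism \<sigma>" using add mult \<sigma>1 by (simp add: field_automorphism_def)
  moreover have "f = map_prod \<sigma> \<sigma>" using f \<tau> by (auto simp: fun_eq_iff)
  ultimately show thesis using that by blast
qed

lemma lin_diff: "lin u v (z - w) = lin u v z - lin u v w"
  by (simp add: lin_def scl_def prod_eq_iff algebra_simps)

lemma lin_scl: "lin u v (scl t z) = scl t (lin u v z)"
  by (simp add: lin_def scl_def prod_eq_iff algebra_simps)

text \<open>The adjugate divided by the determinant, given by its columns.\<close>

definition lin_inv :: "'a::field \<times> 'a \<Rightarrow> 'a \<times> 'a \<Rightarrow> 'a \<times> 'a \<Rightarrow> 'a \<times> 'a" where
  "lin_inv u v = lin (scl (1 / det2 u v) (snd v, - snd u)) (scl (1 / det2 u v) (- fst v, fst u))"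

lemma lin_inv:
  assumes "det2 u v \<noteq> 0"
  shows "lin u v (lin_inv u v z) = z" "lin_inv u v (lin u v z) = z"
proof -
  have "scl (det2 u v) (lin (scl k (snd v, - snd u)) (scl k (- fst v, fst u)) z)
      = scl (k * det2 u v) (lin (snd v, - snd u) (- fst v, fst u) z)" for k
    by (simp add: lin_def scl_def algebra_simps)
  hence inv: "scl (det2 u v) (lin_inv u v z) = lin (snd v, - snd u) (- fst v, fst u) z" for z
    using assms by (simp add: lin_inv_def lin_def scl_def field_simps)
  have cancel: "scl (det2 u v) z = scl (det2 u v) w \<Longrightarrow> z = w" for z w
    using assms by (simp add: scl_def prod_eq_iff)
  show "lin u v (lin_inv u v z) = z"
    by (rule cancel) (simp add: inv flip: lin_scl, simp add: lin_def scl_def det2_def prod_eq_iff algebra_simps)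
  show "lin_inv u v (lin u v z) = z"
    by (rule cancel) (simp add: inv, simp add: lin_def scl_def det2_def prod_eq_iff algebra_simps)
qed

lemma bij_lin: "det2 u v \<noteq> 0 \<Longrightarrow> bij (lin u v)"
  by (rule o_bij[of "lin_inv u v"]) (auto simp: lin_inv)

lemma bij_lin_inv: "det2 u v \<noteq> 0 \<Longrightarrow> bij (lin_inv u v)"
  by (rule o_bij[of "lin u v"]) (auto simp: lin_inv)

lemma line_preserving_semilinear:
  assumes "bij f" "surj \<tau>" "\<And>x y. h (x - y) = h x - h y" "\<And>z. f z = f 0 + h z"
    "\<And>t z. h (scl t z) = scl (\<tau> t) (h z)"
  shows "line_preserving f"
  unfolding line_preserving_def
proof (intro allI impI)
  fix L assume L: "affine_line (L :: ('a \<times> 'a) set)"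
  have h0: "h 0 = 0" using assms(3)[of 0 0] by simp
  have hadd: "h (x + y) = h x + h y" for x y
    using assms(3)[of "x + y" y] by simp
  show "affine_line (f ` L)"
  proof (rule affine_line_imageI[OF L _ assms(2)])
    show "h v \<noteq> 0" if "v \<noteq> 0" for v
      using that assms(1,4) by (metis add_0_right bij_is_inj injD)
    have "f (p + scl t v) = f p + scl (\<tau> t) (h v)" for p v t
      using assms(4)[of "p + scl t v"] assms(4)[of p] assms(5) by (simp add: hadd algebra_simps)
    thus "f (fst p + t * fst v, snd p + t * snd v) =
       (fst (f p) + \<tau> t * fst (h v), snd (f p) + \<tau> t * snd (h v))" for p v t
      by (simp add: scl_def plus_prod_def)
  qed
qed

lemma line_preserving_comp:
  "line_preserving f \<Longrightarrow> line_preserving g \<Longrightarrow> line_preserving (f \<circ> g)"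
  by (simp add: line_preserving_def image_comp [symmetric] del: image_image comp_apply)

lemma line_preserving_lin: "det2 u v \<noteq> 0 \<Longrightarrow> line_preserving (lin u v)"
  by (rule line_preserving_semilinear[where h = "lin u v" and \<tau> = id])
     (auto simp: bij_lin lin_diff lin_scl, simp add: lin_def scl_def plus_prod_def zero_prod_def)

lemma lin_0: "lin u v 0 = 0"
  by (simp add: lin_def scl_def zero_prod_def)

lemma lin_inv_linear:
  "lin_inv u v (z - w) = lin_inv u v z - lin_inv u v w"
  "lin_inv u v (scl t z) = scl t (lin_inv u v z)" "lin_inv u v 0 = 0"
  by (simp_all add: lin_inv_def lin_diff lin_scl lin_0)

lemma line_preserving_lin_inv: "det2 u v \<noteq> 0 \<Longrightarrow> line_preserving (lin_inv u v)"
  by (rule line_preserving_semilinear[where h = "lin_inv u v" and \<tau> = id])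
     (simp_all add: bij_lin_inv lin_inv_linear)

lemma line_preserving_translate: "line_preserving (\<lambda>z. z + c)"
  by (rule line_preserving_semilinear[where h = id and \<tau> = id])
     (auto simp: bij_plus_right algebra_simps)

text \<open>The images of the frame cannot be collinear, because \<open>f\<close> maps the first
  axis onto the line through two of them and is injective. Undoing the affine map that they define
  reduces to a bijection that fixes the frame.\<close>

theorem line_preserving_imp_semilinear:
  fixes f :: "'a::field \<times> 'a \<Rightarrow> 'a \<times> 'a"
  assumes bij: "bij f" and pres: "line_preserving f"
  defines "v \<equiv> f 0" and "u1 \<equiv> f (1, 0) - f 0" and "u2 \<equiv> f (0, 1) - f 0"
  shows "det2 u1 u2 \<noteq> 0" "\<exists>\<sigma>. field_automorphism \<sigma> \<and> (\<forall>z. f z = v + lin u1 u2 (map_prod \<sigma> \<sigma> z))"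
proof -
  have ne: "f (1,0) \<noteq> f 0" "f (0,1) \<noteq> f 0"
    using bij by (auto simp: bij_is_inj inj_eq zero_prod_def)
  have fl: "f ` line 0 (1,0) = line (f 0) u1"
    using line_preserving_through[OF pres bij, of "(1,0)" 0] by (simp add: u1_def zero_prod_def)
  show d: "det2 u1 u2 \<noteq> 0"
  proof
    assume "det2 u1 u2 = 0"
    hence "f (0,1) \<in> line (f 0) u1"
      using ne det2_commute[of u1 u2] by (simp add: mem_line_iff u1_def u2_def)
    hence "f (0,1) \<in> f ` line 0 (1,0)" using fl by simp
    hence "(0,1) \<in> line 0 (1::'a,0::'a)"
      using bij by (simp add: bij_is_inj inj_image_mem_iff)
    thus False by (simp add: mem_line_iff zero_prod_def det2_def)
  qed
  define g where "g = lin_inv u1 u2 \<circ> (\<lambda>z. z + (- v)) \<circ> f"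
  have "bij g" unfolding g_def
    by (intro bij_comp bij bij_lin_inv[OF d]) (rule bij_plus_right)
  moreover have "line_preserving g" unfolding g_def
    by (intro line_preserving_comp pres line_preserving_lin_inv[OF d] line_preserving_translate)
  moreover have "g (0,0) = (0,0)"
    by (simp add: g_def v_def zero_prod_def) (simp add: lin_inv_def lin_def scl_def zero_prod_def)
  moreover have "lin u1 u2 (1,0) = u1" "lin u1 u2 (0,1) = u2"
    by (simp_all add: lin_def scl_def prod_eq_iff)
  hence "g (1,0) = (1,0)" "g (0,1) = (0,1)"
    using lin_inv(2)[OF d, of "(1,0)"] lin_inv(2)[OF d, of "(0,1)"]
    by (simp_all add: g_def v_def flip: u1_def u2_def)
  ultimately obtain \<sigma> where \<sigma>: "field_automorphism \<sigma>" "g = map_prod \<sigma> \<sigma>"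
    by (rule line_preserving_fixing_frame)
  have "f z = v + lin u1 u2 (map_prod \<sigma> \<sigma> z)" for z
    using lin_inv(1)[OF d, of "f z - v"] unfolding \<sigma>(2)[symmetric] by (simp add: g_def)
  thus "\<exists>\<sigma>. field_automorphism \<sigma> \<and> (\<forall>z. f z = v + lin u1 u2 (map_prod \<sigma> \<sigma> z))"
    using \<sigma>(1) by blast
qed

section \<open>Integral automorphisms in adapted linear coordinates\<close>

text \<open>Automorphisms of the Cayley graph with connection set \<open>D\<close>. One implication
  suffices, since on a finite type bijectivity supplies the converse.\<close>

definition diff_preserving :: "('a::ab_group_add) set \<Rightarrow> ('a \<Rightarrow> 'a) set" where
  "diff_preserving D = {f. bij f \<and> (\<forall>z w. z - w \<in> D \<longrightarrow> f z - f w \<in> D)}"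

text \<open>The set of related pairs is finite and is mapped injectively into itself, hence onto
  itself.\<close>

lemma bij_reflects_relation:
  fixes f :: "'a::finite \<Rightarrow> 'a"
  assumes "bij f" "\<And>z w. R z w \<Longrightarrow> R (f z) (f w)" "R (f z) (f w)"
  shows "R z w"
proof -
  have "(z, w) \<in> {(z, w). R z w}"
    by (rule inj_self_map_reflects[where h = "map_prod f f"])
       (use assms in \<open>auto simp: bij_is_inj prod.inj_map\<close>)
  thus ?thesis by simp
qed

lemma diff_preserving_iff:
  fixes f :: "'a::{ab_group_add,finite} \<Rightarrow> 'a"
  assumes "f \<in> diff_preserving D" shows "f z - f w \<in> D \<longleftrightarrow> z - w \<in> D"
  using assms bij_reflects_relation[of f "\<lambda>z w. z - w \<in> D" z w] by (auto simp: diff_preserving_def)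

lemma diff_preserving_comp: "f \<in> diff_preserving D \<Longrightarrow> g \<in> diff_preserving D \<Longrightarrow> f \<circ> g \<in> diff_preserving D"
  by (simp add: diff_preserving_def bij_comp)

lemma diff_preserving_inv:
  fixes g :: "'a::{ab_group_add,finite} \<Rightarrow> 'a"
  assumes g: "g \<in> diff_preserving D" shows "inv_into UNIV g \<in> diff_preserving D"
proof -
  have bij: "bij g" using g by (simp add: diff_preserving_def)
  hence "g (inv_into UNIV g z) = z" for z by (simp add: bij_is_surj surj_f_inv_f)
  hence "z - w \<in> D \<longleftrightarrow> inv_into UNIV g z - inv_into UNIV g w \<in> D" for z w
    using diff_preserving_iff[OF g, of "inv_into UNIV g z" "inv_into UNIV g w"] by simp
  thus ?thesis using bij by (simp add: diff_preserving_def bij_imp_bij_inv)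
qed

text \<open>Passing to the complementary relation costs nothing, because a bijection of a finite set
  reflects whichever of the two relations it preserves.\<close>

lemma Aut_set_iff:
  fixes f :: "'a::{field,finite} \<times> 'a \<Rightarrow> 'a \<times> 'a"
  shows "f \<in> Aut_set \<longleftrightarrow> f \<in> diff_preserving {z. gnorm z \<notin> squares}"
  using bij_reflects_relation[of f "\<lambda>z w. integral_distance z w"]
    bij_reflects_relation[of f "\<lambda>z w. \<not> integral_distance z w"]
  unfolding Aut_set_def diff_preserving_def integral_distance_def mem_Collect_eq by blast

lemma AffAut_set_iff: "f \<in> AffAut_set \<longleftrightarrow> f \<in> Aut_set \<and> line_preserving f"
  by (simp add: AffAut_set_def line_preserving_def)

context
  fixes u v :: "'a::{field,finite} \<times> 'a" and D
  assumes det: "det2 u v \<noteq> 0" and D: "\<And>z. z \<in> D \<longleftrightarrow> gnorm (lin u v z) \<notin> squares"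
begin

lemma Aut_conj_lin:
  "f \<in> Aut_set \<Longrightarrow> lin_inv u v \<circ> f \<circ> lin u v \<in> diff_preserving D"
  "g \<in> diff_preserving D \<Longrightarrow> lin u v \<circ> g \<circ> lin_inv u v \<in> Aut_set"
  unfolding Aut_set_iff
  by (simp_all add: diff_preserving_def D bij_comp bij_lin bij_lin_inv lin_diff lin_inv_linear lin_inv
      det del: split_paired_All flip: lin_diff lin_inv_linear)

lemma bij_betw_Aut_conj_lin:
  "bij_betw (\<lambda>f. lin_inv u v \<circ> f \<circ> lin u v) Aut_set (diff_preserving D)"
  by (rule bij_betw_byWitness[where f' = "\<lambda>g. lin u v \<circ> g \<circ> lin_inv u v"])
     (auto simp: fun_eq_iff lin_inv[OF det] Aut_conj_lin)

lemma card_Aut_set: "card (Aut_set :: ('a \<times> 'a \<Rightarrow> 'a \<times> 'a) set) = card (diff_preserving D)"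
  by (rule bij_betw_same_card[OF bij_betw_Aut_conj_lin])

lemma card_AffAut_set:
  "card (AffAut_set :: ('a \<times> 'a \<Rightarrow> 'a \<times> 'a) set) = card {f \<in> diff_preserving D. line_preserving f}"
proof (rule bij_betw_same_card)
  show "bij_betw (\<lambda>f. lin_inv u v \<circ> f \<circ> lin u v) AffAut_set {f \<in> diff_preserving D. line_preserving f}"
    by (rule bij_betw_byWitness[where f' = "\<lambda>g. lin u v \<circ> g \<circ> lin_inv u v"])
       (auto simp: fun_eq_iff lin_inv[OF det] Aut_conj_lin AffAut_set_iff
         intro!: line_preserving_comp line_preserving_lin line_preserving_lin_inv det)
qed

end

section \<open>Counting the semilinear maps that preserve a difference set\<close>

lemma field_automorphism_simps:
  assumes "field_automorphism \<sigma>"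
  shows "\<sigma> 0 = 0" "\<sigma> 1 = 1" "\<sigma> (x + y) = \<sigma> x + \<sigma> y" "\<sigma> (x * y) = \<sigma> x * \<sigma> y"
    "\<sigma> (- x) = - \<sigma> x" "\<sigma> (x - y) = \<sigma> x - \<sigma> y" "\<sigma> x = \<sigma> y \<longleftrightarrow> x = y" "\<sigma> x = 0 \<longleftrightarrow> x = 0"
    "bij \<sigma>" "surj \<sigma>"
proof -
  show add: "\<sigma> (x + y) = \<sigma> x + \<sigma> y" for x y using assms by (simp add: field_automorphism_def)
  show zero: "\<sigma> 0 = 0" using add[of 0 0] by (simp only: add_0_right add_cancel_right_right)
  show neg: "\<sigma> (- x) = - \<sigma> x" for x using add[of x "- x"] zero by (simp add: eq_neg_iff_add_eq_0 add.commute)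
  show "\<sigma> (x - y) = \<sigma> x - \<sigma> y" for x using add[of x "- y"] neg by simp
  show inj: "\<sigma> x = \<sigma> y \<longleftrightarrow> x = y" for x y
    using assms by (auto simp: field_automorphism_def bij_def inj_eq)
  show "\<sigma> x = 0 \<longleftrightarrow> x = 0" using inj[of x 0] zero by simp
qed (use assms in \<open>auto simp: field_automorphism_def bij_is_surj\<close>)

lemma map_prod_field_automorphism:
  assumes "field_automorphism \<sigma>"
  shows "map_prod \<sigma> \<sigma> (z - w) = map_prod \<sigma> \<sigma> z - map_prod \<sigma> \<sigma> w" "map_prod \<sigma> \<sigma> 0 = 0"
    "map_prod \<sigma> \<sigma> (scl t z) = scl (\<sigma> t) (map_prod \<sigma> \<sigma> z)" "bij (map_prod \<sigma> \<sigma>)"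
  using field_automorphism_simps(9,10)[OF assms]
  by (cases z; cases w;
      simp add: scl_def field_automorphism_simps[OF assms] zero_prod_def prod.inj_map bij_def map_prod_surj)+

definition semilinear :: "'a::field \<times> 'a \<Rightarrow> ('a \<times> 'a) \<times> 'a \<times> 'a \<Rightarrow> ('a \<Rightarrow> 'a) \<Rightarrow> 'a \<times> 'a \<Rightarrow> 'a \<times> 'a" where
  "semilinear v u \<sigma> z = v + lin (fst u) (snd u) (map_prod \<sigma> \<sigma> z)"

lemma semilinear_frame:
  assumes "field_automorphism \<sigma>"
  shows "semilinear v u \<sigma> 0 = v" "semilinear v u \<sigma> (1, 0) = v + fst u" "semilinear v u \<sigma> (0, 1) = v + snd u"
    "semilinear v u \<sigma> (x, 0) = v + scl (\<sigma> x) (fst u)"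
  using field_automorphism_simps(1,2)[OF assms] map_prod_field_automorphism(2)[OF assms]
  by (simp_all add: semilinear_def lin_0) (simp_all add: lin_def scl_def prod_eq_iff)

text \<open>Since \<open>D\<close> is stable under field automorphisms acting on the coordinates,
  whether a semilinear map preserves \<open>D\<close> depends on its linear part alone. Translation,
  linear part and field automorphism therefore vary independently, and the images of 0, of the unit
  vectors and of the first axis recover them.\<close>

lemma card_line_preserving:
  fixes D :: "('a::{field,finite} \<times> 'a) set"
  assumes D: "\<And>\<sigma> z. field_automorphism \<sigma> \<Longrightarrow> map_prod \<sigma> \<sigma> z \<in> D \<longleftrightarrow> z \<in> D"
  defines "U \<equiv> {u. det2 (fst u) (snd u) \<noteq> 0 \<and> (\<forall>z\<in>D. lin (fst u) (snd u) z \<in> D)}"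
  shows "card {f \<in> diff_preserving D. line_preserving f}
    = CARD('a \<times> 'a) * (card U * card (Collect field_automorphism :: ('a \<Rightarrow> 'a) set))"
proof -
  let ?P = "(UNIV :: ('a \<times> 'a) set) \<times> U \<times> (Collect field_automorphism :: ('a \<Rightarrow> 'a) set)"
  have "bij_betw (\<lambda>(v, u, \<sigma>). semilinear v u \<sigma>) ?P {f \<in> diff_preserving D. line_preserving f}"
    unfolding bij_betw_def
  proof
    show "inj_on (\<lambda>(v, u, \<sigma>). semilinear v u \<sigma>) ?P"
    proof (rule inj_onI)
      fix p p' assume h: "p \<in> ?P" "p' \<in> ?P"
        "(case p of (v, u, \<sigma>) \<Rightarrow> semilinear v u \<sigma>) = (case p' of (v, u, \<sigma>) \<Rightarrow> semilinear v u \<sigma>)"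
      obtain v u1 u2 \<sigma> where p: "p = (v, (u1, u2), \<sigma>)" by (metis surj_pair)
      obtain v' u1' u2' \<sigma>' where p': "p' = (v', (u1', u2'), \<sigma>')" by (metis surj_pair)
      from h have \<sigma>: "field_automorphism \<sigma>" "field_automorphism \<sigma>'" and u: "(u1, u2) \<in> U"
        and eq: "semilinear v (u1, u2) \<sigma> = semilinear v' (u1', u2') \<sigma>'" by (auto simp: p p')
      have v: "v = v'" and u': "u1 = u1'" "u2 = u2'"
        using semilinear_frame[OF \<sigma>(1), of v "(u1, u2)"] semilinear_frame[OF \<sigma>(2), of v' "(u1', u2')"] eq
        by auto
      have "\<sigma> x = \<sigma>' x" for x
      proof -
        have "u1 \<noteq> 0" using u by (auto simp: U_def det2_def)
        moreover have "scl (\<sigma> x) u1 = scl (\<sigma>' x) u1"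
          using semilinear_frame(4)[OF \<sigma>(1), of v "(u1, u2)" x]
            semilinear_frame(4)[OF \<sigma>(2), of v' "(u1', u2')" x] eq v u' by simp
        ultimately show ?thesis by (auto simp: scl_def prod_eq_iff)
      qed
      thus "p = p'" using v u' by (auto simp: p p')
    qed
  next
    show "(\<lambda>(v, u, \<sigma>). semilinear v u \<sigma>) ` ?P = {f \<in> diff_preserving D. line_preserving f}"
    proof (intro equalityI subsetI)
      fix f assume "f \<in> (\<lambda>(v, u, \<sigma>). semilinear v u \<sigma>) ` ?P"
      then obtain v u \<sigma> where u: "u \<in> U" and \<sigma>: "field_automorphism \<sigma>" and f: "f = semilinear v u \<sigma>"
        by auto
      have det: "det2 (fst u) (snd u) \<noteq> 0" using u by (simp add: U_def)
      have "f = (\<lambda>z. v + z) \<circ> lin (fst u) (snd u) \<circ> map_prod \<sigma> \<sigma>"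
        by (simp add: f semilinear_def fun_eq_iff)
      hence "bij f" by (simp add: bij_comp bij_lin det map_prod_field_automorphism[OF \<sigma>] bij_plus_right add.commute[of v])
      moreover have "f z - f w = lin (fst u) (snd u) (map_prod \<sigma> \<sigma> (z - w))" for z w
        by (simp add: f semilinear_def lin_diff map_prod_field_automorphism(1)[OF \<sigma>])
      moreover have "lin (fst u) (snd u) (map_prod \<sigma> \<sigma> z) \<in> D" if "z \<in> D" for z
        using u that D[OF \<sigma>, of z] by (simp add: U_def)
      ultimately have "f \<in> diff_preserving D" by (simp add: diff_preserving_def del: split_paired_All)
      moreover have "line_preserving f"
      proof (rule line_preserving_semilinear[where \<tau> = \<sigma> and h = "\<lambda>z. lin (fst u) (snd u) (map_prod \<sigma> \<sigma> z)"])
        show "f z = f 0 + lin (fst u) (snd u) (map_prod \<sigma> \<sigma> z)" for z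
          by (simp add: f semilinear_def map_prod_field_automorphism(2)[OF \<sigma>] lin_0)
      qed (simp_all add: \<open>bij f\<close> lin_diff lin_scl map_prod_field_automorphism[OF \<sigma>] field_automorphism_simps[OF \<sigma>])
      ultimately show "f \<in> {f \<in> diff_preserving D. line_preserving f}" by simp
    next
      fix f assume f: "f \<in> {f \<in> diff_preserving D. line_preserving f}"
      hence bij: "bij f" and pres: "line_preserving f" by (auto simp: diff_preserving_def)
      define v u1 u2 where frame: "v = f 0" "u1 = f (1,0) - f 0" "u2 = f (0,1) - f 0"
      note L = line_preserving_imp_semilinear[OF bij pres]
      from L(2) obtain \<sigma> where \<sigma>: "field_automorphism \<sigma>"
        and fz: "\<And>z. f z = v + lin u1 u2 (map_prod \<sigma> \<sigma> z)"
        unfolding frame by blast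
      have "lin u1 u2 z \<in> D" if "z \<in> D" for z
      proof -
        have "z \<in> range (map_prod \<sigma> \<sigma>)"
          using map_prod_field_automorphism(4)[OF \<sigma>] by (metis UNIV_I bij_is_surj)
        then obtain y where y: "z = map_prod \<sigma> \<sigma> y" by auto
        hence "y - 0 \<in> D" using that D[OF \<sigma>, of y] by simp
        hence "f y - f 0 \<in> D" using f unfolding diff_preserving_def by blast
        thus ?thesis by (simp only: fz[of y] y frame(1)[symmetric] add_diff_cancel_left')
      qed
      hence "(u1, u2) \<in> U" using L(1) by (simp add: U_def frame)
      moreover have "f = semilinear v (u1, u2) \<sigma>" by (simp add: fun_eq_iff fz semilinear_def)
      ultimately show "f \<in> (\<lambda>(v, u, \<sigma>). semilinear v u \<sigma>) ` ?P"
        using \<sigma> by (intro image_eqI[of _ _ "(v, (u1, u2), \<sigma>)"]) simp_all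
    qed
  qed
  hence "card ?P = card {f \<in> diff_preserving D. line_preserving f}" by (rule bij_betw_same_card)
  thus ?thesis by (simp add: card_cartesian_product)
qed

section \<open>Normal form and order of the group generated by the given maps\<close>

definition G_map :: "'a::field \<times> 'a \<Rightarrow> 'a \<times> 'a \<Rightarrow> bool \<Rightarrow> ('a \<Rightarrow> 'a) \<Rightarrow> 'a \<times> 'a \<Rightarrow> 'a \<times> 'a" where
  "G_map v \<alpha> e \<sigma> z = v + \<alpha> \<odot> map_prod \<sigma> \<sigma> (if e then gconj z else z)"

definition G_params :: "(('a::field \<times> 'a) \<times> ('a \<times> 'a) \<times> bool \<times> ('a \<Rightarrow> 'a)) set" where
  "G_params = UNIV \<times> {\<alpha>. gnorm \<alpha> \<in> squares - {0}} \<times> UNIV \<times> Collect field_automorphism"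

lemma gmult_algebra:
  "\<alpha> \<odot> (z + w) = \<alpha> \<odot> z + \<alpha> \<odot> w" "\<alpha> \<odot> (z - w) = \<alpha> \<odot> z - \<alpha> \<odot> w"
  "\<alpha> \<odot> (\<beta> \<odot> z) = (\<alpha> \<odot> \<beta>) \<odot> z" "gconj (\<alpha> \<odot> z) = gconj \<alpha> \<odot> gconj z" "gconj (z + w) = gconj z + gconj w"
  "gconj (gconj z) = z" "gnorm (gconj z) = gnorm z" "\<alpha> \<odot> 0 = 0" "gconj 0 = 0" "(1, 0) \<odot> z = z"
  by (simp_all add: gmult_def gconj_def gnorm_def prod_eq_iff algebra_simps power2_eq_square)

lemma map_prod_gmult:
  assumes "field_automorphism \<sigma>"
  shows "map_prod \<sigma> \<sigma> (\<alpha> \<odot> z) = map_prod \<sigma> \<sigma> \<alpha> \<odot> map_prod \<sigma> \<sigma> z"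
    "map_prod \<sigma> \<sigma> (z + w) = map_prod \<sigma> \<sigma> z + map_prod \<sigma> \<sigma> w"
    "map_prod \<sigma> \<sigma> (gconj z) = gconj (map_prod \<sigma> \<sigma> z)"
    "gnorm (map_prod \<sigma> \<sigma> z) = \<sigma> (gnorm z)"
  by (cases \<alpha>; cases z; cases w;
      simp add: gmult_def gconj_def gnorm_def power2_eq_square field_automorphism_simps[OF assms])+

lemma field_automorphism_squares:
  assumes "field_automorphism \<sigma>" "a \<in> squares - {0}" shows "\<sigma> a \<in> squares - {0}"
  using assms(2) by (auto simp: squares_def power2_eq_square field_automorphism_simps[OF assms(1)])

lemma field_automorphism_comp:
  "field_automorphism \<sigma> \<Longrightarrow> field_automorphism \<tau> \<Longrightarrow> field_automorphism (\<sigma> \<circ> \<tau>)"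
  by (simp add: field_automorphism_def bij_comp)

lemma field_automorphism_id: "field_automorphism id"
  by (simp add: field_automorphism_def)

lemma squares_minus_0_mult: "a \<in> squares - {0} \<Longrightarrow> b \<in> squares - {0} \<Longrightarrow> a * b \<in> squares - {0}"
  using squares_mult[of a b] by simp

text \<open>Normal forms are closed under composition: moving conjugation and
  \<open>\<sigma>\<close> past a multiplication by \<open>\<beta>\<close> only changes
  \<open>\<beta>\<close> to its image, whose norm is the image under \<open>\<sigma>\<close> of the
  old norm and hence still a non-zero square.\<close>

lemma G_map_comp:
  assumes "(v, \<alpha>, e, \<sigma>) \<in> G_params" "(w, \<beta>, d, \<tau>) \<in> G_params"
  obtains u \<gamma> where "(u, \<gamma>, e \<noteq> d, \<sigma> \<circ> \<tau>) \<in> G_params"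
    "G_map v \<alpha> e \<sigma> \<circ> G_map w \<beta> d \<tau> = G_map u \<gamma> (e \<noteq> d) (\<sigma> \<circ> \<tau>)"
proof
  have \<sigma>: "field_automorphism \<sigma>" "field_automorphism \<tau>" using assms by (auto simp: G_params_def)
  let ?\<gamma> = "\<alpha> \<odot> map_prod \<sigma> \<sigma> (if e then gconj \<beta> else \<beta>)"
  have "gnorm ?\<gamma> = gnorm \<alpha> * \<sigma> (gnorm \<beta>)"
    by (simp add: gnorm_gmult map_prod_gmult[OF \<sigma>(1)] gmult_algebra)
  hence "gnorm ?\<gamma> \<in> squares - {0}"
    using assms squares_minus_0_mult[of "gnorm \<alpha>" "\<sigma> (gnorm \<beta>)"] field_automorphism_squares[OF \<sigma>(1), of "gnorm \<beta>"]
    by (simp add: G_params_def)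
  thus "(G_map v \<alpha> e \<sigma> w, ?\<gamma>, e \<noteq> d, \<sigma> \<circ> \<tau>) \<in> G_params"
    using field_automorphism_comp[OF \<sigma>] by (simp add: G_params_def)
  have comp: "map_prod (\<sigma> \<circ> \<tau>) (\<sigma> \<circ> \<tau>) z = map_prod \<sigma> \<sigma> (map_prod \<tau> \<tau> z)" for z
    by (cases z) simp
  have "G_map v \<alpha> e \<sigma> (G_map w \<beta> d \<tau> z) = G_map (G_map v \<alpha> e \<sigma> w) ?\<gamma> (e \<noteq> d) (\<sigma> \<circ> \<tau>) z" for z
    by (cases e; cases d)
       (simp_all add: G_map_def gmult_algebra map_prod_gmult[OF \<sigma>(1)] map_prod_gmult[OF \<sigma>(2)] add.assoc comp)
  thus "G_map v \<alpha> e \<sigma> \<circ> G_map w \<beta> d \<tau> = G_map (G_map v \<alpha> e \<sigma> w) ?\<gamma> (e \<noteq> d) (\<sigma> \<circ> \<tau>)"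
    by (simp add: fun_eq_iff)
qed

lemma G_generators_G_map:
  fixes f :: "'a::field \<times> 'a \<Rightarrow> 'a \<times> 'a"
  assumes "f \<in> G_generators"
  shows "\<exists>v \<alpha> e \<sigma>. (v, \<alpha>, e, \<sigma>) \<in> G_params \<and> f = G_map v \<alpha> e \<sigma>"
proof -
  have one: "gnorm (1, 0) \<in> squares - {0 :: 'a}"
    by (auto simp: gnorm_def squares_def intro: exI[of _ 1])
  from assms consider (trans) v where "f = (\<lambda>z. z + v)" | (conj) "f = gconj"
    | (mult) \<alpha> where "f = (\<lambda>z. \<alpha> \<odot> z)" "gnorm \<alpha> \<in> squares - {0}"
    | (frob) \<sigma> where "f = map_prod \<sigma> \<sigma>" "field_automorphism \<sigma>"
    by (auto simp: G_generators_def)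
  thus ?thesis
  proof cases
    case trans
    hence "(v, (1,0), False, id) \<in> G_params \<and> f = G_map v (1,0) False id"
      using one by (simp add: field_automorphism_id prod.map_id G_params_def G_map_def fun_eq_iff gmult_algebra)
    thus ?thesis by blast
  next
    case conj
    hence "(0, (1::'a,0), True, id) \<in> G_params \<and> f = G_map 0 (1,0) True id"
      using one by (simp add: field_automorphism_id prod.map_id G_params_def G_map_def fun_eq_iff gmult_algebra del: split_paired_All)
    thus ?thesis by blast
  next
    case mult
    hence "(0, \<alpha>, False, id) \<in> G_params \<and> f = G_map 0 \<alpha> False id"
      by (simp add: field_automorphism_id prod.map_id G_params_def G_map_def fun_eq_iff)
    thus ?thesis by blast
  next
    case frob
    hence "(0, (1,0), False, \<sigma>) \<in> G_params \<and> f = G_map 0 (1,0) False \<sigma>"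
      using one by (simp add: G_params_def G_map_def fun_eq_iff gmult_algebra)
    thus ?thesis by blast
  qed
qed

text \<open>Inverses come for free: left composition with \<open>f\<close> is an injective self-map
  of the finite set \<open>H\<close>, so it hits \<open>id\<close>. This avoids computing the
  inverse of a normal form.\<close>

lemma finite_comp_closed_subgroup:
  fixes H :: "('a::finite \<Rightarrow> 'a) set"
  assumes bij: "\<And>f. f \<in> H \<Longrightarrow> bij f" and comp: "\<And>f g. f \<in> H \<Longrightarrow> g \<in> H \<Longrightarrow> f \<circ> g \<in> H" and id: "id \<in> H"
  shows "subgroup H (BijGroup UNIV)"
proof (rule group.subgroupI[OF group_BijGroup])
  show "H \<subseteq> carrier (BijGroup UNIV)" using bij by (auto simp: carrier_BijGroup_UNIV)
  show "H \<noteq> {}" using id by blast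
  show "f \<otimes>\<^bsub>BijGroup UNIV\<^esub> g \<in> H" if "f \<in> H" "g \<in> H" for f g
    using that bij comp by (simp add: mult_BijGroup_UNIV)
  show "inv\<^bsub>BijGroup UNIV\<^esub> f \<in> H" if f: "f \<in> H" for f
  proof -
    have "inj_on ((\<circ>) f) H"
      using bij_is_inj[OF bij[OF f]] by (intro inj_onI) (simp add: fun_eq_iff inj_eq)
    hence "(\<circ>) f ` H = H" using comp f by (intro endo_inj_surj) auto
    then obtain g where "g \<in> H" "f \<circ> g = id" using id by (metis imageE)
    moreover from this have "inv_into UNIV f = g"
      using bij[OF f] by (metis bij_is_inj inj_iff comp_assoc comp_id id_comp)
    ultimately show ?thesis by (simp add: inv_BijGroup_UNIV[OF bij[OF f]])
  qed
qed

lemma G_set_eq: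
  "(G_set :: ('a::{field,finite} \<times> 'a \<Rightarrow> 'a \<times> 'a) set) = (\<lambda>(v, \<alpha>, e, \<sigma>). G_map v \<alpha> e \<sigma>) ` G_params"
    (is "_ = ?H")
proof
  let ?B = "BijGroup (UNIV :: ('a \<times> 'a) set)"
  interpret B: group ?B by (rule group_BijGroup)
  have gen: "G_generators \<subseteq> ?H" 
  proof
    fix f :: "'a \<times> 'a \<Rightarrow> 'a \<times> 'a" assume "f \<in> G_generators"
    then obtain v \<alpha> e \<sigma> where "(v, \<alpha>, e, \<sigma>) \<in> G_params" "f = G_map v \<alpha> e \<sigma>"
      using G_generators_G_map by blast
    thus "f \<in> ?H" by (intro image_eqI[of _ _ "(v, \<alpha>, e, \<sigma>)"]) simp_all
  qed
  have gen_bij: "bij f" if "f \<in> G_generators" for f :: "'a \<times> 'a \<Rightarrow> 'a \<times> 'a"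
    using that G_generators_AffAut by (auto simp: AffAut_set_def Aut_set_def)
  have bijG: "bij f" if "f \<in> G_set" for f :: "'a \<times> 'a \<Rightarrow> 'a \<times> 'a"
    using B.generate_incl[of G_generators] gen_bij that
    by (auto simp: G_set_def carrier_BijGroup_UNIV)
  have comp: "f \<circ> g \<in> G_set" if "f \<in> G_set" "g \<in> G_set" for f g :: "'a \<times> 'a \<Rightarrow> 'a \<times> 'a"
    using generate.eng[of f ?B G_generators g] that bijG by (simp add: G_set_def mult_BijGroup_UNIV)
  have inc: "f \<in> G_set" if "f \<in> G_generators" for f :: "'a \<times> 'a \<Rightarrow> 'a \<times> 'a"
    using that by (simp add: G_set_def generate.incl)
  show H: "?H \<subseteq> G_set"
  proof clarify
    fix v \<alpha> :: "'a \<times> 'a" and e and \<sigma> :: "'a \<Rightarrow> 'a" assume p: "(v, \<alpha>, e, \<sigma>) \<in> G_params"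
    \<comment> \<open>The identity is written as the translation by 0, so that every factor is a
      generator in either case.\<close>
    have "G_map v \<alpha> e \<sigma> = (\<lambda>z. z + v) \<circ> (\<lambda>z. \<alpha> \<odot> z) \<circ> map_prod \<sigma> \<sigma> \<circ> (if e then gconj else (\<lambda>z. z + 0))"
      by (simp add: G_map_def fun_eq_iff)
    moreover have tr: "(\<lambda>z. z + w) \<in> G_set" for w :: "'a \<times> 'a"
      by (rule inc) (unfold G_generators_def, blast)
    moreover have gens: "(\<lambda>z. \<alpha> \<odot> z) \<in> G_set" "map_prod \<sigma> \<sigma> \<in> G_set" "gconj \<in> (G_set :: ('a \<times> 'a \<Rightarrow> 'a \<times> 'a) set)"
      using p unfolding G_params_def by (auto intro!: inc) (unfold G_generators_def, blast+)
    moreover have "(if e then gconj else (\<lambda>z. z + 0)) \<in> (G_set :: ('a \<times> 'a \<Rightarrow> 'a \<times> 'a) set)"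
      by (cases e) (simp_all only: if_True if_False gens tr)
    ultimately show "G_map v \<alpha> e \<sigma> \<in> G_set"
      by (simp only: comp)
  qed
  have "subgroup ?H ?B"
  proof (rule finite_comp_closed_subgroup)
    show "bij f" if "f \<in> ?H" for f using that H bijG by blast
    show "f \<circ> g \<in> ?H" if "f \<in> ?H" "g \<in> ?H" for f g
    proof -
      from that obtain v \<alpha> e \<sigma> w \<beta> d \<tau> where p: "(v, \<alpha>, e, \<sigma>) \<in> G_params" "(w, \<beta>, d, \<tau>) \<in> G_params"
        "f = G_map v \<alpha> e \<sigma>" "g = G_map w \<beta> d \<tau>" by auto
      show ?thesis using G_map_comp[OF p(1,2)] p(3,4) by (metis (no_types, lifting) case_prod_conv image_eqI)
    qed
    have "(\<lambda>z. z + 0) \<in> (G_generators :: ('a \<times> 'a \<Rightarrow> 'a \<times> 'a) set)" unfolding G_generators_def by blast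
    thus "id \<in> ?H" using gen by (auto simp: id_def)
  qed
  thus "G_set \<subseteq> ?H" unfolding G_set_def using gen B.generate_subgroup_incl by blast
qed

text \<open>The normal form is unique: its values at 0, 1, the field elements and i determine in
  turn the translation, the multiplier, the field automorphism and the conjugation flag. The last
  needs i and -i to differ, hence odd characteristic.\<close>

lemma card_G_set:
  assumes "(2::'a::{field,finite}) \<noteq> 0"
  shows "card (G_set :: ('a \<times> 'a \<Rightarrow> 'a \<times> 'a) set) = CARD('a \<times> 'a) *
    (card {\<alpha> :: 'a \<times> 'a. gnorm \<alpha> \<in> squares - {0}} * (2 * card (Collect field_automorphism :: ('a \<Rightarrow> 'a) set)))"
proof -
  have "inj_on (\<lambda>(v, \<alpha>, e, \<sigma>). G_map v \<alpha> e \<sigma>) (G_params :: (('a \<times> 'a) \<times> _) set)"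
  proof (rule inj_onI)
    fix x y :: "('a \<times> 'a) \<times> ('a \<times> 'a) \<times> bool \<times> ('a \<Rightarrow> 'a)"
    assume h: "x \<in> G_params" "y \<in> G_params"
      "(case x of (v, \<alpha>, e, \<sigma>) \<Rightarrow> G_map v \<alpha> e \<sigma>) = (case y of (v, \<alpha>, e, \<sigma>) \<Rightarrow> G_map v \<alpha> e \<sigma>)"
    obtain v1 v2 a1 a2 e \<sigma> where x: "x = ((v1,v2), (a1,a2), e, \<sigma>)" by (metis surj_pair)
    obtain w1 w2 b1 b2 d \<tau> where y: "y = ((w1,w2), (b1,b2), d, \<tau>)" by (metis surj_pair)
    from h have p: "((v1,v2), (a1,a2), e, \<sigma>) \<in> G_params" "((w1,w2), (b1,b2), d, \<tau>) \<in> G_params"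
      and eq: "G_map (v1,v2) (a1,a2) e \<sigma> = G_map (w1,w2) (b1,b2) d \<tau>"
      by (simp_all add: x y)
    from p have \<sigma>: "field_automorphism \<sigma>" "field_automorphism \<tau>" and "gnorm (a1,a2) \<noteq> 0"
      by (auto simp: G_params_def)
    hence a: "a1 \<noteq> 0 \<or> a2 \<noteq> 0" by (auto simp: gnorm_def)
    note s = field_automorphism_simps[OF \<sigma>(1)] field_automorphism_simps[OF \<sigma>(2)]
    have e: "G_map (v1,v2) (a1,a2) e \<sigma> (x,y) = G_map (w1,w2) (b1,b2) d \<tau> (x,y)" for x y
      by (simp add: eq)
    have v: "v1 = w1" "v2 = w2"
      using e[of 0 0] s by (cases e; cases d; simp add: G_map_def gmult_def gconj_def)+
    have ab: "a1 = b1" "a2 = b2"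
      using e[of 1 0] s v by (cases e; cases d; simp add: G_map_def gmult_def gconj_def)+
    have "a1 * \<sigma> x = a1 * \<tau> x" "a2 * \<sigma> x = a2 * \<tau> x" for x
      using e[of x 0] s v ab by (cases e; cases d; simp add: G_map_def gmult_def gconj_def)+
    hence \<sigma>\<tau>: "\<sigma> = \<tau>" using a by auto
    have "e = d"
    proof (rule ccontr)
      assume "e \<noteq> d"
      hence "a1 = - a1" "a2 = - a2"
        using e[of 0 1] s v ab by (cases e; cases d; simp add: G_map_def gmult_def gconj_def)+
      hence "2 * a1 = 0" "2 * a2 = 0" by (simp_all only: mult_2 eq_neg_iff_add_eq_0)
      thus False using a assms by simp
    qed
    thus "x = y" using v ab \<sigma>\<tau> by (simp add: x y)
  qed
  thus ?thesis unfolding G_set_eq by (simp add: card_image G_params_def card_cartesian_product)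
qed

text \<open>A square root \<open>j\<close> of -1 splits the norm into the product of the independent
  linear forms x + j y and x - j y. The first factor and the norm are thus free coordinates, ranging
  over the non-zero elements and the non-zero squares.\<close>

lemma card_gnorm_square:
  fixes j :: "'a::{field,finite}"
  assumes j: "j * j = - 1" and two: "(2::'a) \<noteq> 0"
  shows "card {\<alpha> :: 'a \<times> 'a. gnorm \<alpha> \<in> squares - {0}} = (CARD('a) - 1) * card (squares - {0 :: 'a})"
proof -
  have j0: "j \<noteq> 0" using j by auto
  have N: "gnorm \<alpha> = (fst \<alpha> + j * snd \<alpha>) * (fst \<alpha> - j * snd \<alpha>)" for \<alpha>
  proof -
    have "(fst \<alpha> + j * snd \<alpha>) * (fst \<alpha> - j * snd \<alpha>) = (fst \<alpha>)\<^sup>2 - (j * j) * (snd \<alpha>)\<^sup>2"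
      by (simp add: algebra_simps power2_eq_square)
    thus ?thesis by (simp add: j gnorm_def)
  qed
  have eq: "x = x' \<and> y = y'" if "x + j * y = x' + j * y'" "x - j * y = x' - j * y'" for x y x' y'
  proof -
    have "2 * x = 2 * x'" "2 * (j * y) = 2 * (j * y')" using that by algebra+
    thus ?thesis using two j0 by simp
  qed
  have "bij_betw (\<lambda>\<alpha>. (fst \<alpha> + j * snd \<alpha>, gnorm \<alpha>)) {\<alpha> :: 'a \<times> 'a. gnorm \<alpha> \<in> squares - {0}}
      ((UNIV - {0}) \<times> (squares - {0}))"
    unfolding bij_betw_def
  proof
    show "inj_on (\<lambda>\<alpha>. (fst \<alpha> + j * snd \<alpha>, gnorm \<alpha>)) {\<alpha> :: 'a \<times> 'a. gnorm \<alpha> \<in> squares - {0}}"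
    proof (rule inj_onI)
      fix \<alpha> \<beta> :: "'a \<times> 'a" assume h: "\<alpha> \<in> {\<alpha>. gnorm \<alpha> \<in> squares - {0}}"
        "(fst \<alpha> + j * snd \<alpha>, gnorm \<alpha>) = (fst \<beta> + j * snd \<beta>, gnorm \<beta>)"
      hence "fst \<alpha> + j * snd \<alpha> \<noteq> 0" using N[of \<alpha>] by auto
      moreover have "(fst \<alpha> + j * snd \<alpha>) * (fst \<alpha> - j * snd \<alpha>) = (fst \<alpha> + j * snd \<alpha>) * (fst \<beta> - j * snd \<beta>)"
        using h(2) N[of \<alpha>] N[of \<beta>] by (metis prod.inject)
      ultimately have "fst \<alpha> - j * snd \<alpha> = fst \<beta> - j * snd \<beta>" by simp
      hence "fst \<alpha> = fst \<beta> \<and> snd \<alpha> = snd \<beta>" using h(2) by (intro eq) simp_all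
      thus "\<alpha> = \<beta>" by (simp add: prod_eq_iff)
    qed
  next
    show "(\<lambda>\<alpha>. (fst \<alpha> + j * snd \<alpha>, gnorm \<alpha>)) ` {\<alpha> :: 'a \<times> 'a. gnorm \<alpha> \<in> squares - {0}}
        = (UNIV - {0}) \<times> (squares - {0})"
    proof (intro equalityI subsetI)
      fix p assume "p \<in> (\<lambda>\<alpha>. (fst \<alpha> + j * snd \<alpha>, gnorm \<alpha>)) ` {\<alpha> :: 'a \<times> 'a. gnorm \<alpha> \<in> squares - {0}}"
      thus "p \<in> (UNIV - {0}) \<times> (squares - {0})" using N by auto
    next
      fix p :: "'a \<times> 'a" assume p: "p \<in> (UNIV - {0}) \<times> (squares - {0})"
      \<comment> \<open>Solves x + j y = a and x - j y = b / a for the prescribed first factor a and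
        norm b.\<close>
      define \<alpha> where "\<alpha> = ((fst p + snd p / fst p) / 2, (fst p - snd p / fst p) / (2 * j))"
      have jy: "j * snd \<alpha> = (fst p - snd p / fst p) / 2"
        using j0 by (simp add: \<alpha>_def)
      have half: "(a + b) / 2 + (a - b) / 2 = a" "(a + b) / 2 - (a - b) / 2 = b" for a b :: 'a
        using two by (simp_all flip: add_divide_distrib diff_divide_distrib mult_2)
      have "fst \<alpha> + j * snd \<alpha> = fst p" "fst \<alpha> - j * snd \<alpha> = snd p / fst p"
        unfolding jy by (simp_all add: \<alpha>_def half)
      moreover from this have "gnorm \<alpha> = snd p" using p by (auto simp: N)
      ultimately show "p \<in> (\<lambda>\<alpha>. (fst \<alpha> + j * snd \<alpha>, gnorm \<alpha>)) ` {\<alpha>. gnorm \<alpha> \<in> squares - {0}}"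
        using p by (intro image_eqI[of _ _ \<alpha>]) (simp_all add: mem_Times_iff prod_eq_iff)
    qed
  qed
  from bij_betw_same_card[OF this] show ?thesis by (simp add: card_cartesian_product)
qed

lemma group_index_G_set:
  "group_index (AffAut_group :: ('a::{field,finite} \<times> 'a \<Rightarrow> 'a \<times> 'a) monoid) G_set
    * card (G_set :: ('a \<times> 'a \<Rightarrow> 'a \<times> 'a) set) = card (AffAut_set :: ('a \<times> 'a \<Rightarrow> 'a \<times> 'a) set)"
  using group.lagrange[OF group_AffAut_group G_set_subgroup]
  by (simp add: group_index_def Coset.order_def AffAut_group_def mult.commute)

text \<open>Translation by 1 permutes the summands of the sum of all elements, but also adds the
  cardinality to that sum.\<close>

lemma of_nat_CARD_eq_0: "(of_nat CARD('a::{ab_group_add,comm_ring_1,finite}) :: 'a) = 0"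
proof -
  have "(\<Sum>x\<in>UNIV. x + 1 :: 'a) = (\<Sum>x\<in>UNIV. x)"
    by (rule sum.reindex_bij_betw) (rule bij_plus_right)
  thus ?thesis by (simp add: sum.distrib)
qed

section \<open>The field with five elements\<close>

definition axes :: "('a::field \<times> 'a) set" where
  "axes = {z. (fst z = 0) \<noteq> (snd z = 0)}"

lemma diff_in_axes: "z - w \<in> axes \<longleftrightarrow> (fst z = fst w) \<noteq> (snd z = snd w)"
  by (simp add: axes_def)

lemma swap_axes: "prod.swap z - prod.swap w \<in> axes \<longleftrightarrow> z - w \<in> axes"
  by (auto simp: diff_in_axes)

text \<open>Two points of a row have images that agree in exactly one coordinate, and comparing with
  a third point shows that it is the same coordinate throughout the row. So a row is mapped into a
  row or into a column, and all rows must make the same choice.\<close>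

lemma axes_automorphism_rows:
  fixes f :: "'a::{field,finite} \<times> 'a \<Rightarrow> 'a \<times> 'a"
  assumes f: "f \<in> diff_preserving axes"
  shows "(\<forall>t s s'. snd (f (s, t)) = snd (f (s', t))) \<or> (\<forall>t s s'. fst (f (s, t)) = fst (f (s', t)))"
proof -
  have inj: "f z = f w \<longleftrightarrow> z = w" for z w using f by (auto simp: diff_preserving_def bij_is_inj inj_eq)
  have adj: "(fst (f (s, t)) = fst (f (s', t))) \<noteq> (snd (f (s, t)) = snd (f (s', t)))" if "s \<noteq> s'" for s s' t
    using diff_preserving_iff[OF f, of "(s, t)" "(s', t)"] that unfolding diff_in_axes by simp
  let ?S = "\<lambda>t. \<forall>s s'. snd (f (s, t)) = snd (f (s', t))"
  let ?F = "\<lambda>t. \<forall>s s'. fst (f (s, t)) = fst (f (s', t))"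
  have dichotomy: "?S t \<or> ?F t" for t
    using adj[of _ _ t] by (metis (full_types))
  \<comment> \<open>By finiteness the two images would be a full row and a full column. These meet,
    so by injectivity both come from the same row, whose image would then be a single point.\<close>
  have "False" if S: "?S t" and F: "?F t'" for t t'
  proof -
    have "inj (\<lambda>s. fst (f (s, t)))" using S inj by (intro injI) (metis prod.inject prod_eqI)
    hence "surj (\<lambda>s. fst (f (s, t)))" by (simp add: finite_UNIV_inj_surj)
    then obtain s where s: "fst (f (0, t')) = fst (f (s, t))" by (rule surjE)
    have "inj (\<lambda>s. snd (f (s, t')))" using F inj by (intro injI) (metis prod.inject prod_eqI)
    hence "surj (\<lambda>s. snd (f (s, t')))" by (simp add: finite_UNIV_inj_surj)
    then obtain s' where s': "snd (f (0, t)) = snd (f (s', t'))" by (rule surjE)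
    have "fst (f (s, t)) = fst (f (s', t'))" using F s by metis
    moreover have "snd (f (s, t)) = snd (f (s', t'))" using S s' by metis
    ultimately have "f (s, t) = f (s', t')" by (rule prod_eqI)
    hence "t = t'" using inj by blast
    hence "f (0, t) = f (1, t)" using S F by (intro prod_eqI) blast+
    thus False using inj by auto
  qed
  thus ?thesis using dichotomy by blast
qed

lemma swap_diff_preserving: "prod.swap \<in> diff_preserving (axes :: ('a::field \<times> 'a) set)"
  unfolding diff_preserving_def using swap_axes by (auto simp del: split_paired_All)

text \<open>Precomposing with the swap turns the dichotomy for rows into one for columns. If the
  columns also kept the second coordinate constant, it would be constant on the whole plane, against
  surjectivity.\<close>

lemma axes_automorphism_product:
  fixes f :: "'a::{field,finite} \<times> 'a \<Rightarrow> 'a \<times> 'a"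
  assumes f: "f \<in> diff_preserving axes" and rows: "\<forall>t s s'. snd (f (s, t)) = snd (f (s', t))"
  shows "\<exists>\<pi> \<rho>. bij \<pi> \<and> bij \<rho> \<and> f = map_prod \<pi> \<rho>"
proof -
  have bij: "bij f" using f by (simp add: diff_preserving_def)
  have "(\<forall>t s s'. snd (f (t, s)) = snd (f (t, s'))) \<or> (\<forall>t s s'. fst (f (t, s)) = fst (f (t, s')))"
    using axes_automorphism_rows[OF diff_preserving_comp[OF f swap_diff_preserving]] by simp
  moreover have "\<not> (\<forall>t s s'. snd (f (t, s)) = snd (f (t, s')))"
  proof
    assume "\<forall>t s s'. snd (f (t, s)) = snd (f (t, s'))"
    hence c: "snd (f z) = snd (f (0,0))" for z using rows by (cases z) metis
    obtain z where "f z = (0, snd (f (0,0)) + 1)" using bij by (metis bij_pointE)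
    thus False using c[of z] by simp
  qed
  ultimately have cols: "\<forall>t s s'. fst (f (t, s)) = fst (f (t, s'))" by blast
  define \<pi> where "\<pi> s = fst (f (s, 0))" for s
  define \<rho> where "\<rho> t = snd (f (0, t))" for t
  have eq: "f = map_prod \<pi> \<rho>"
  proof (rule ext)
    fix z show "f z = map_prod \<pi> \<rho> z"
      unfolding \<pi>_def \<rho>_def using rows cols by (cases z) (metis map_prod_simp prod.collapse)
  qed
  have "inj (map_prod \<pi> \<rho>)" using bij eq by (simp add: bij_is_inj)
  hence inj: "map_prod \<pi> \<rho> z = map_prod \<pi> \<rho> w \<longleftrightarrow> z = w" for z w by (simp add: inj_eq)
  have "inj \<pi>" using inj[of "(_, 0)" "(_, 0)"] by (intro injI) simp
  moreover have "inj \<rho>" using inj[of "(0, _)" "(0, _)"] by (intro injI) simp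
  ultimately have "bij \<pi>" "bij \<rho>" by (simp_all add: bij_def finite_UNIV_inj_surj)
  thus ?thesis using eq by blast
qed

text \<open>The group is the wreath product of the symmetric group with the group of order two. Its
  two cosets are disjoint because the first output coordinate depends on the first input coordinate
  in one and is independent of it in the other.\<close>

lemma card_axes_automorphisms:
  "card (diff_preserving axes :: ('a::{field,finite} \<times> 'a \<Rightarrow> 'a \<times> 'a) set) = 2 * (fact CARD('a))\<^sup>2"
proof -
  let ?B = "{\<pi> :: 'a \<Rightarrow> 'a. bij \<pi>}"
  let ?P = "(\<lambda>(\<pi>, \<rho>). map_prod \<pi> \<rho>) ` (?B \<times> ?B)"
  have "?B = {\<pi>. \<pi> permutes UNIV}"
    by (auto intro: permutes_bij bij_imp_permutes)
  hence B: "card ?B = fact CARD('a)"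
    using card_permutations[OF refl, of "UNIV :: 'a set"] by simp
  have inj: "inj_on (\<lambda>(\<pi>, \<rho>). map_prod \<pi> \<rho>) (?B \<times> ?B)"
    by (auto simp: inj_on_def fun_eq_iff)
  have P: "?P \<subseteq> diff_preserving axes"
  proof clarify
    fix \<pi> \<rho> :: "'a \<Rightarrow> 'a" assume b: "bij \<pi>" "bij \<rho>"
    hence "bij (map_prod \<pi> \<rho>)" by (simp add: bij_def prod.inj_map map_prod_surj)
    thus "map_prod \<pi> \<rho> \<in> diff_preserving axes"
      using b unfolding diff_preserving_def diff_in_axes by (auto simp: bij_is_inj inj_eq)
  qed
  have eq: "diff_preserving axes = ?P \<union> (\<circ>) prod.swap ` ?P"
  proof (intro equalityI subsetI)
    fix f :: "'a \<times> 'a \<Rightarrow> 'a \<times> 'a" assume f: "f \<in> diff_preserving axes"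
    from axes_automorphism_rows[OF f] show "f \<in> ?P \<union> (\<circ>) prod.swap ` ?P" (is ?goal)
    proof
      assume "\<forall>t s s'. snd (f (s, t)) = snd (f (s', t))"
      with axes_automorphism_product[OF f] show ?goal by blast
    next
      assume "\<forall>t s s'. fst (f (s, t)) = fst (f (s', t))"
      hence "\<exists>\<pi> \<rho>. bij \<pi> \<and> bij \<rho> \<and> prod.swap \<circ> f = map_prod \<pi> \<rho>"
        by (intro axes_automorphism_product diff_preserving_comp swap_diff_preserving f) simp
      then obtain \<pi> \<rho> where "bij \<pi>" "bij \<rho>" and g: "prod.swap \<circ> f = map_prod \<pi> \<rho>" by blast
      moreover have "f = prod.swap \<circ> map_prod \<pi> \<rho>" by (simp add: fun_eq_iff flip: g)
      ultimately show ?goal by blast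
    qed
  next
    fix f :: "'a \<times> 'a \<Rightarrow> 'a \<times> 'a" assume "f \<in> ?P \<union> (\<circ>) prod.swap ` ?P"
    thus "f \<in> diff_preserving axes"
      using P by (auto intro!: diff_preserving_comp swap_diff_preserving)
  qed
  have "?P \<inter> (\<circ>) prod.swap ` ?P = {}"
  proof (rule equals0I)
    fix f :: "'a \<times> 'a \<Rightarrow> 'a \<times> 'a" assume f: "f \<in> ?P \<inter> (\<circ>) prod.swap ` ?P"
    obtain \<pi> \<rho> where b: "bij \<pi>" and e1: "f = map_prod \<pi> \<rho>" using f by auto
    obtain \<pi>' \<rho>' where "f = prod.swap \<circ> map_prod \<pi>' \<rho>'" using f by auto
    with e1 have e: "map_prod \<pi> \<rho> = prod.swap \<circ> map_prod \<pi>' \<rho>'" by simp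
    have "\<pi> s = \<rho>' 0" for s using fun_cong[OF e, of "(s, 0)"] by simp
    hence "\<pi> 0 = \<pi> 1" by simp
    thus False using b by (simp add: bij_is_inj inj_eq)
  qed
  moreover have "card ((\<circ>) prod.swap ` ?P) = card ?P"
    by (rule card_image) (auto simp: inj_on_def fun_eq_iff)
  moreover have "card ?P = (fact CARD('a))\<^sup>2"
    by (simp add: card_image[OF inj] card_cartesian_product B power2_eq_square)
  ultimately show ?thesis unfolding eq by (subst card_Un_disjoint) simp_all
qed

text \<open>These are the monomial matrices: both columns must lie on axes, and a non-zero
  determinant puts them on different ones.\<close>

lemma card_axes_linear:
  "card {u :: ('a::{field,finite} \<times> 'a) \<times> 'a \<times> 'a. det2 (fst u) (snd u) \<noteq> 0 \<and> (\<forall>z\<in>axes. lin (fst u) (snd u) z \<in> axes)}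
    = 2 * (CARD('a) - 1)\<^sup>2" (is "card ?U = _")
proof -
  let ?N = "(UNIV - {0}) \<times> (UNIV - {0}) :: ('a \<times> 'a) set"
  let ?d = "\<lambda>(a, b). ((a, 0), (0, b)) :: ('a \<times> 'a) \<times> 'a \<times> 'a"
  let ?s = "\<lambda>(a, b). ((0, a), (b, 0)) :: ('a \<times> 'a) \<times> 'a \<times> 'a"
  have "?U = ?d ` ?N \<union> ?s ` ?N"
  proof (intro equalityI subsetI)
    fix u assume "u \<in> ?U"
    moreover obtain a b c d where u: "u = ((a, b), (c, d))" by (metis surj_pair)
    moreover have "(1, 0) \<in> (axes :: ('a \<times> 'a) set)" "(0, 1) \<in> (axes :: ('a \<times> 'a) set)"
      by (simp_all add: axes_def)
    ultimately have "lin (a, b) (c, d) (1, 0) \<in> axes" "lin (a, b) (c, d) (0, 1) \<in> axes" "det2 (a, b) (c, d) \<noteq> 0"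
      by (auto simp del: split_paired_All)
    thus "u \<in> ?d ` ?N \<union> ?s ` ?N"
      unfolding u by (auto simp: axes_def lin_def scl_def det2_def)
  qed (auto simp: axes_def lin_def scl_def det2_def)
  moreover have "?d ` ?N \<inter> ?s ` ?N = {}" by auto
  moreover have "card (?d ` ?N) = (CARD('a) - 1)\<^sup>2" "card (?s ` ?N) = (CARD('a) - 1)\<^sup>2"
    by (subst card_image; force simp: inj_on_def card_cartesian_product power2_eq_square)+
  ultimately show ?thesis by (simp add: card_Un_disjoint)
qed

context
  assumes card5: "CARD('a::{field,finite}) = 5"
begin

lemma five_eq_0: "(5::'a) = 0"
  using of_nat_CARD_eq_0[where 'a = 'a] by (simp add: card5)

lemma numerals_GF5: "(4::'a) = - 1" "(2::'a) \<noteq> 0" "(3::'a) \<noteq> 0" "(2::'a) \<noteq> 1"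
proof -
  show "(4::'a) = - 1" using five_eq_0 by (simp add: eq_neg_iff_add_eq_0)
  show "(2::'a) \<noteq> 0"
  proof
    assume "(2::'a) = 0"
    \<comment> \<open>A combination of 2 and 5 with value 1, so the two cannot both vanish.\<close>
    hence "5 - 2 * 2 = (0 - 0 * 0 :: 'a)" using five_eq_0 by (simp only:)
    thus False by simp
  qed
  show "(3::'a) \<noteq> 0"
  proof
    assume "(3::'a) = 0"
    hence "2 * 3 - 5 = (2 * 0 - 0 :: 'a)" using five_eq_0 by (simp only:)
    thus False by simp
  qed
  show "(2::'a) \<noteq> 1"
  proof
    assume "(2::'a) = 1"
    hence "2 - 1 = (1 - 1 :: 'a)" by (simp only:)
    thus False by simp
  qed
qed

lemma UNIV_GF5: "(UNIV :: 'a set) = {0, 1, - 1, 2, - 2}"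
proof (rule sym, rule card_eq_UNIV_imp_eq_UNIV)
  have "(4::'a) \<noteq> 0" by (simp add: numerals_GF5(1))
  hence "(1::'a) \<noteq> -1" "(2::'a) \<noteq> - 1" "(2::'a) \<noteq> - 2"
    using numerals_GF5(2-4) by (simp_all add: eq_neg_iff_add_eq_0)
  moreover from this have "- 1 \<noteq> (1::'a)" "- 2 \<noteq> (1::'a)" "- 2 \<noteq> (2::'a)"
    by (metis minus_minus)+
  ultimately show "card {0, 1, - 1, 2, - 2 :: 'a} = CARD('a)"
    using numerals_GF5(2-4) by (simp add: card5)
qed simp

lemma two_not_square: "(2::'a) \<notin> {0, 1, - 1}" "- (2::'a) \<notin> {0, 1, - 1}"
  using numerals_GF5(2-4) by (simp_all add: eq_neg_iff_add_eq_0 neg_eq_iff_add_eq_0)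

lemma squares_GF5: "(squares :: 'a set) = {0, 1, - 1}"
proof -
  have "(squares :: 'a set) = (\<lambda>b. b\<^sup>2) ` UNIV" by (auto simp: squares_def)
  also have "\<dots> = {0, 1, - 1}" unfolding UNIV_GF5 by (auto simp: power2_eq_square numerals_GF5)
  finally show ?thesis .
qed

lemma field_automorphisms_GF5: "Collect field_automorphism = {id :: 'a \<Rightarrow> 'a}"
proof -
  have "\<sigma> = id" if "field_automorphism \<sigma>" for \<sigma> :: "'a \<Rightarrow> 'a"
  proof
    fix x :: 'a
    note s = field_automorphism_simps[OF that]
    have "\<sigma> 2 = 2" using s(3)[of 1 1] s(2) by simp
    moreover have "x \<in> {0, 1, - 1, 2, - 2}" using UNIV_GF5 by blast
    ultimately show "\<sigma> x = id x" using s(1,2,5) by auto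
  qed
  thus ?thesis using field_automorphism_id by auto
qed

text \<open>The vectors (1, 1) and (1, -1) span the only two non-integral directions. In this basis
  the norm is 2 (s^2 + t^2), where non-zero squares are 1 or -1. If both coordinates are non-zero
  the value is 0, 1 or -1, a square; if exactly one is, the value is 2 or -2, a non-square.\<close>

lemma axes_GF5: "z \<in> axes \<longleftrightarrow> gnorm (lin (1, 1) (1, - 1) z) \<notin> (squares :: 'a set)"
proof -
  have sq: "x = 0 \<or> x\<^sup>2 = 1 \<or> x\<^sup>2 = - 1" for x :: 'a
  proof -
    have "x \<in> {0, 1, - 1, 2, - 2}" using UNIV_GF5 by blast
    thus ?thesis by (auto simp: power2_eq_square numerals_GF5)
  qed
  have "gnorm (lin (1, 1) (1, - 1) z) = 2 * (fst z)\<^sup>2 + 2 * (snd z)\<^sup>2"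
    by (simp add: gnorm_def lin_def scl_def power2_eq_square algebra_simps)
  moreover have "x \<noteq> 0" if "x\<^sup>2 = 1 \<or> x\<^sup>2 = - 1" for x :: 'a
    using that by auto
  ultimately show ?thesis
    using sq[of "fst z"] sq[of "snd z"] two_not_square
    unfolding squares_GF5 by (auto simp: axes_def numerals_GF5)
qed

theorem automorphism_groups_GF5:
  "card (Aut_set :: ('a \<times> 'a \<Rightarrow> 'a \<times> 'a) set) = 28800"
  "card (AffAut_set :: ('a \<times> 'a \<Rightarrow> 'a \<times> 'a) set) = 800"
  "group_index (AffAut_group :: ('a \<times> 'a \<Rightarrow> 'a \<times> 'a) monoid) G_set = 2"
proof -
  have det: "det2 (1, 1) (1, - 1 :: 'a) \<noteq> 0"
    using numerals_GF5(2) by (simp add: det2_def)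
  show "card (Aut_set :: ('a \<times> 'a \<Rightarrow> 'a \<times> 'a) set) = 28800"
    by (simp add: card_Aut_set[OF det axes_GF5] card_axes_automorphisms card5 fact_numeral)
  have "map_prod \<sigma> \<sigma> z \<in> axes \<longleftrightarrow> z \<in> axes" if "field_automorphism \<sigma>" for \<sigma> and z :: "'a \<times> 'a"
    by (cases z) (simp add: axes_def field_automorphism_simps[OF that])
  from card_line_preserving[OF this]
  show Aff: "card (AffAut_set :: ('a \<times> 'a \<Rightarrow> 'a \<times> 'a) set) = 800"
    by (simp add: card_AffAut_set[OF det axes_GF5] card_axes_linear field_automorphisms_GF5 card5 card_cartesian_product)
  have "squares - {0 :: 'a} = {1, - 1}" using squares_GF5 by auto
  moreover have "(1::'a) \<noteq> - 1" using numerals_GF5(2) by (simp add: eq_neg_iff_add_eq_0)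
  ultimately have "card (squares - {0 :: 'a}) = 2" by simp
  moreover have "(2::'a) * 2 = - 1" by (simp add: numerals_GF5)
  ultimately have "card (G_set :: ('a \<times> 'a \<Rightarrow> 'a \<times> 'a) set) = 400"
    using card_gnorm_square[of "2::'a"] numerals_GF5(2)
    by (simp add: card_G_set field_automorphisms_GF5 card5 card_cartesian_product)
  thus "group_index (AffAut_group :: ('a \<times> 'a \<Rightarrow> 'a \<times> 'a) monoid) G_set = 2"
    using group_index_G_set[where 'a = 'a] by (simp add: Aff)
qed

end

section \<open>The field with nine elements\<close>

definition F3 :: "'a::field set" where
  "F3 = {0, 1, - 1}"

locale GF9 =
  fixes \<omega> :: "'a::{field,finite}"
  assumes card9: "CARD('a) = 9" and three: "(3::'a) = 0" and omega: "\<omega> * \<omega> = - 1"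
    and generates: "\<exists>a\<in>F3. \<exists>b\<in>F3. x = a + b * \<omega>"

lemma char3_simps:
  fixes x y :: "'a::field"
  assumes "(3::'a::field) = 0"
  shows "(2::'a) = - 1" "(4::'a) = 1" "(5::'a) = - 1" "x + x = - x" "x + (x + y) = y - x" "(1::'a) \<noteq> - 1" "- 1 \<noteq> (1::'a)"
proof -
  have "(2::'a) = 3 - 1" "(4::'a) = 3 + 1" "(5::'a) = 2 * 3 - 1" by simp_all
  thus 2: "(2::'a) = - 1" and "(4::'a) = 1" and "(5::'a) = - 1" unfolding assms by simp_all
  show x: "x + x = - x" using 2 by (metis mult_2 mult_minus1)
  show "x + (x + y) = y - x" unfolding add.assoc[symmetric] x by simp
  show "(1::'a) \<noteq> - 1"
  proof
    assume "(1::'a) = - 1"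
    hence "(2::'a) = 1" using 2 by simp
    hence "2 - 1 = (1 - 1 :: 'a)" by (simp only:)
    thus False by simp
  qed
  thus "- 1 \<noteq> (1::'a)" by metis
qed

lemma F3_closed:
  assumes "(3::'a::field) = 0" and "a \<in> F3" "b \<in> (F3 :: 'a set)"
  shows "a + b \<in> F3" "a - b \<in> F3" "a * b \<in> F3" "- a \<in> F3"
proof -
  note two = char3_simps(1)[OF assms(1)]
  have "(1::'a) + 1 = - 1" "- 1 - 1 = (1::'a)" "- 1 + - 1 = (1::'a)" "1 - - 1 = (- 1 :: 'a)"
    by (simp_all add: two)
  thus "a + b \<in> F3" "a - b \<in> F3" "a * b \<in> F3" "- a \<in> F3"
    using assms(2,3) unfolding F3_def
    by (elim insertE emptyE; simp only: simp_thms insert_iff diff_0 diff_0_right add_0_left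
      add_0_right minus_zero minus_minus mult_1_left mult_1_right mult_zero_left mult_zero_right mult_minus_left
      mult_minus_right diff_self add.right_inverse add.left_inverse)+
qed

lemma card_F3: "(3::'a::field) = 0 \<Longrightarrow> card (F3 :: 'a set) = 3"
  by (simp add: F3_def char3_simps)

lemma finite_F3: "finite F3"
  by (simp add: F3_def)

text \<open>Two equal combinations would express \<open>x\<close> as a quotient of elements of F_3,
  so the nine combinations are distinct and exhaust the field.\<close>

lemma GF9_span:
  fixes x :: "'a::{field,finite}"
  assumes card: "CARD('a) = 9" and three: "(3::'a) = 0" and x: "x \<notin> F3"
  shows "\<exists>a\<in>F3. \<exists>b\<in>F3. z = a + b * x"
proof -
  have inj: "inj_on (\<lambda>(a, b). a + b * x) (F3 \<times> F3)"
  proof (rule inj_onI)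
    fix p q assume p: "p \<in> F3 \<times> F3" and q: "q \<in> F3 \<times> F3"
      and eq: "(case p of (a, b) \<Rightarrow> a + b * x) = (case q of (a, b) \<Rightarrow> a + b * x)"
    define d where "d = snd p - snd q"
    define e where "e = fst q - fst p"
    have d: "d \<in> F3" and e: "e \<in> F3"
      using p q by (auto simp: d_def e_def mem_Times_iff F3_closed(2)[OF three])
    have "d * x = e" using eq by (simp add: d_def e_def case_prod_beta algebra_simps)
    hence "d = 0 \<or> x = e \<or> x = - e" using d by (auto simp: F3_def)
    hence "d = 0" using e x F3_closed(4)[OF three e e] by auto
    moreover from this \<open>d * x = e\<close> have "e = 0" by simp
    ultimately show "p = q" by (simp add: d_def e_def prod_eq_iff)
  qed
  have "card (F3 :: 'a set) = 3" by (rule card_F3[OF three])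
  hence "card ((\<lambda>(a, b). a + b * x) ` (F3 \<times> F3)) = CARD('a)"
    by (simp only: card_image[OF inj] card_cartesian_product card)
  hence "(\<lambda>(a, b). a + b * x) ` (F3 \<times> F3) = UNIV"
    by (intro card_eq_UNIV_imp_eq_UNIV) (simp_all add: finite_F3)
  hence "z \<in> (\<lambda>(a, b). a + b * x) ` (F3 \<times> F3)" by simp
  thus ?thesis by fast
qed

lemma GF9_exists:
  assumes card: "CARD('a::{field,finite}) = 9"
  shows "\<exists>\<omega> :: 'a. GF9 \<omega>"
proof -
  have "(3::'a) * 3 = 0" using of_nat_CARD_eq_0[where 'a = 'a] by (simp add: card)
  hence three: "(3::'a) = 0" unfolding mult_eq_0_iff by blast
  note char3 = char3_simps[OF three]
  have "card (F3 :: 'a set) = 3" by (rule card_F3[OF three])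
  hence "(F3 :: 'a set) \<noteq> UNIV" using card by auto
  then obtain x :: 'a where x: "x \<notin> F3" by auto
  obtain a b where a: "a \<in> F3" and b: "b \<in> F3" and xx: "x * x = a + b * x"
    using GF9_span[OF card three x] by blast
  \<comment> \<open>Completing the square: -b/2 equals b in characteristic 3, so
    \<open>y * y\<close> lies in F_3. It can only be -1, because the square roots of 0 and 1 already
    lie in F_3.\<close>
  define y where "y = x + b"
  have "y * y = x * x + (b * x + b * x) + b * b" by (simp add: y_def algebra_simps)
  also have "\<dots> = a + b * b" by (simp only: char3(4) xx) simp
  finally have "y * y \<in> F3"
    using F3_closed[OF three] a b by simp
  moreover have y: "y \<notin> F3"
    using x F3_closed(2)[OF three _ b, of y] by (metis y_def add_diff_cancel_right')
  moreover have "y * y \<noteq> 0" using y by (auto simp: F3_def)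
  moreover have "y * y \<noteq> 1" using y square_eq_1_iff by (auto simp: F3_def)
  ultimately have "y * y = - 1" by (auto simp: F3_def)
  hence "GF9 y" using GF9_span[OF card three y] card three by (simp add: GF9_def)
  thus ?thesis by blast
qed

definition cone :: "('a::field \<times> 'a) set" where
  "cone = {z. z \<noteq> 0 \<and> (fst z = 0 \<or> snd z = 0 \<or> fst z = snd z \<or> fst z = - snd z)}"

text \<open>
  Over \<open>F\<^sub>9 = F\<^sub>3(\<omega>)\<close> the value at \<open>(a + b \<omega>, c + d \<omega>)\<close> is \<open>- \<omega> (a d - b c)\<close>: up to a constant this is
  the determinant of the matrix attached to a point.
\<close>

definition wronski :: "'a::field \<times> 'a \<Rightarrow> 'a" where
  "wronski z = fst z ^ 3 * snd z - fst z * snd z ^ 3"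

lemma cone_iff_wronski: "z \<in> cone \<longleftrightarrow> z \<noteq> 0 \<and> wronski z = 0"
proof -
  have "wronski z = fst z * snd z * ((fst z - snd z) * (fst z + snd z))"
    by (simp add: wronski_def power3_eq_cube algebra_simps)
  thus ?thesis by (auto simp: cone_def eq_neg_iff_add_eq_0)
qed

context GF9
begin

abbreviation K :: "'a set" where "K \<equiv> F3"


text \<open>One representative for each point of the projective line over F_3, so that every element
  of the cone is \<open>scl x k\<close> in a unique way.\<close>

definition directions :: "('a \<times> 'a) set" where
  "directions = {(1, 0), (0, 1), (1, 1), (1, - 1)}"

lemmas char3 = char3_simps[OF three]

lemma omega_power2: "\<omega>\<^sup>2 = - 1" "\<omega> * (\<omega> * x) = - x"
  using omega by (simp_all add: power2_eq_square flip: mult.assoc)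

lemma omega_notin: "\<omega> \<notin> K"
  using omega by (auto simp: F3_def char3(6,7))

lemma neg_self_iff: "x = - x \<longleftrightarrow> x = 0" for x :: 'a
  using char3(4)[of x] by (metis add.left_inverse add_cancel_right_right add.inverse_neutral minus_minus)

lemma omega_neq: "\<omega> \<noteq> 0" "\<omega> \<noteq> 1" "\<omega> \<noteq> - 1" "1 \<noteq> \<omega>" "- 1 \<noteq> \<omega>" "- \<omega> \<noteq> 1" "1 \<noteq> - \<omega>" "\<omega> \<noteq> - \<omega>" "- \<omega> \<noteq> \<omega>"
proof -
  show *: "\<omega> \<noteq> 0" "\<omega> \<noteq> 1" "\<omega> \<noteq> - 1" using omega_notin by (auto simp: F3_def)
  from * show "1 \<noteq> \<omega>" "- 1 \<noteq> \<omega>" "- \<omega> \<noteq> 1" "1 \<noteq> - \<omega>" by (metis minus_minus)+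
  from * show "\<omega> \<noteq> - \<omega>" "- \<omega> \<noteq> \<omega>" by (metis neg_self_iff)+
qed

lemma omega_lincomb_eq_0:
  assumes "a \<in> K" "b \<in> K" "a + b * \<omega> = 0" shows "a = 0 \<and> b = 0"
  using assms by (auto simp: F3_def omega_neq add_eq_0_iff)

lemma cube_add: "(x + y) ^ 3 = x ^ 3 + y ^ 3" for x y :: 'a
proof -
  have "(x + y) ^ 3 = x ^ 3 + y ^ 3 + 3 * (x * x * y + x * y * y)"
    by (simp add: power3_eq_cube algebra_simps)
  thus ?thesis by (simp add: three)
qed

lemma cube_diff: "(x - y) ^ 3 = x ^ 3 - y ^ 3" for x y :: 'a
  using cube_add[of "x - y" y] by (simp add: algebra_simps)

lemma cube_K: "k \<in> K \<Longrightarrow> k ^ 3 = k"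
  by (auto simp: F3_def)

lemma cube_omega: "\<omega> ^ 3 = - \<omega>"
  by (simp add: power3_eq_cube omega)

text \<open>\<open>wronski\<close> is, up to sign, the Moore determinant of the two coordinates.
  Cubing is additive and trivial on F_3, so a matrix over F_3 multiplies it by its
  determinant.\<close>

lemma wronski_lincomb:
  assumes "k \<in> K \<times> K" "l \<in> K \<times> K"
  shows "wronski (scl x k + scl y l) = (x ^ 3 * y - x * y ^ 3) * det2 k l"
proof -
  obtain a b c d where kl: "k = (a, b)" "l = (c, d)" and "a \<in> K" "b \<in> K" "c \<in> K" "d \<in> K"
    using assms by auto
  hence "a ^ 3 = a" "b ^ 3 = b" "c ^ 3 = c" "d ^ 3 = d" using cube_K by blast+
  thus ?thesis
    by (simp add: kl wronski_def scl_def det2_def cube_add power_mult_distrib algebra_simps)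
qed

lemma scl_in_cone:
  assumes "k \<in> K \<times> K" "scl x k \<noteq> 0" shows "scl x k \<in> cone"
  using wronski_lincomb[OF assms(1) assms(1), of x 0] assms(2)
  by (simp add: cone_iff_wronski scl_def zero_prod_def plus_prod_def)

lemma directions_F3: "directions \<subseteq> K \<times> K"
  by (auto simp: directions_def F3_def)

lemma cone_decompose:
  assumes "z \<in> cone" obtains x k where "x \<noteq> 0" "k \<in> directions" "z = scl x k"
proof -
  obtain s t where z: "z = (s, t)" by (cases z)
  from assms have "s \<noteq> 0 \<or> t \<noteq> 0" and "s = 0 \<or> t = 0 \<or> s = t \<or> s = - t"
    by (auto simp: cone_def z zero_prod_def)
  then consider "t \<noteq> 0" "z = scl t (0, 1)" | "s \<noteq> 0" "z = scl s (1, 0)" | "s \<noteq> 0" "z = scl s (1, 1)"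
    | "s \<noteq> 0" "z = scl s (1, - 1)"
    by (auto simp: z scl_def)
  thus thesis using that by cases (auto simp: directions_def)
qed

lemma directions_scl_eq:
  assumes "k \<in> directions" "l \<in> directions" "x \<noteq> 0" "scl x k = scl y l" shows "x = y \<and> k = l"
  using assms by (auto simp: directions_def scl_def char3(1,6,7))

lemma scl_0: "scl 0 k = 0" and scl_1: "scl 1 k = k" and scl_minus_1: "scl (- 1) k = - k"
  by (simp_all add: scl_def zero_prod_def prod_eq_iff)

lemma det2_directions:
  assumes "k \<in> directions" "l \<in> K \<times> K" shows "det2 k l = 0 \<longleftrightarrow> l \<in> {0, k, - k}"
proof
  assume d: "det2 k l = 0"
  obtain a b where l: "l = (a, b)" "a \<in> K" "b \<in> K" using assms(2) by auto
  \<comment> \<open>The scalar is read off at a coordinate where \<open>k\<close> is 1.\<close>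
  have "l = scl (if fst k = 1 then a else b) k"
    using d assms(1) by (auto simp: l directions_def det2_def scl_def add_eq_0_iff)
  moreover have "(if fst k = 1 then a else b) \<in> K" using l by simp
  ultimately obtain c where c: "l = scl c k" "c \<in> K" by blast
  from c(2) consider "c = 0" | "c = 1" | "c = - 1" unfolding F3_def by blast
  thus "l \<in> {0, k, - k}" by cases (simp_all add: c(1) scl_0 scl_1 scl_minus_1)
next
  assume "l \<in> {0, k, - k}"
  then consider "l = 0" | "l = k" | "l = - k" by blast
  thus "det2 k l = 0" by cases (simp_all add: det2_def)
qed

lemma proportional_K:
  assumes "x ^ 3 * y - x * y ^ 3 = 0" "x \<noteq> 0"
  shows "y \<in> (\<lambda>a. a * x) ` K"
proof -
  have "x ^ 3 * y - x * y ^ 3 = x * y * ((x - y) * (x + y))"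
    by (simp add: power3_eq_cube algebra_simps)
  thus ?thesis using assms by (auto simp: add_eq_0_iff F3_def)
qed

lemma squares_GF9: "(squares :: 'a set) = {0, 1, - 1, \<omega>, - \<omega>}"
proof (intro equalityI subsetI)
  fix x :: 'a assume "x \<in> squares"
  then obtain y where y: "x = y\<^sup>2" by (auto simp: squares_def)
  obtain a b where ab: "a \<in> K" "b \<in> K" "y = a + b * \<omega>" using generates by blast
  have "x = a * a - b * b - a * b * \<omega>"
    by (simp add: y ab(3) power2_eq_square algebra_simps omega_power2 char3)
  thus "x \<in> {0, 1, - 1, \<omega>, - \<omega>}" using ab(1,2) by (auto simp: F3_def)
next
  fix x :: 'a assume "x \<in> {0, 1, - 1, \<omega>, - \<omega>}"
  moreover have "0 = (0::'a)\<^sup>2" "1 = (1::'a)\<^sup>2" "- 1 = \<omega>\<^sup>2" "\<omega> = (1 - \<omega>)\<^sup>2" "- \<omega> = (1 + \<omega>)\<^sup>2"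
    by (simp_all add: power2_eq_square algebra_simps omega_power2 char3 omega)
  ultimately show "x \<in> squares" unfolding squares_def by blast
qed

lemma card_squares_GF9: "card (squares - {0 :: 'a}) = 4"
proof -
  have "squares - {0 :: 'a} = {1, - 1, \<omega>, - \<omega>}" using squares_GF9 by (auto simp: omega_neq)
  moreover have "card {1, - 1, \<omega>, - \<omega>} = 4"
    by (simp add: omega_neq char3(6,7))
  ultimately show ?thesis by simp
qed

lemma field_automorphism_cube: "field_automorphism (\<lambda>x :: 'a. x ^ 3)"
proof -
  have "inj (\<lambda>x :: 'a. x ^ 3)"
    by (rule injI) (metis cube_diff eq_iff_diff_eq_0 power_eq_0_iff)
  hence "bij (\<lambda>x :: 'a. x ^ 3)" by (simp add: bij_def finite_UNIV_inj_surj)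
  thus ?thesis by (simp add: field_automorphism_def cube_add power_mult_distrib)
qed

text \<open>F_3 is fixed, so an automorphism is determined by the image of \<open>\<omega>\<close>,
  which must again be a square root of -1.\<close>

lemma field_automorphisms_GF9: "card (Collect field_automorphism :: ('a \<Rightarrow> 'a) set) = 2"
proof -
  have "\<sigma> \<in> {id, \<lambda>x. x ^ 3}" if \<sigma>: "field_automorphism \<sigma>" for \<sigma> :: "'a \<Rightarrow> 'a"
  proof -
    note s = field_automorphism_simps[OF \<sigma>]
    have rep: "\<sigma> (a + b * \<omega>) = a + b * \<sigma> \<omega>" if "a \<in> K" "b \<in> K" for a b
      using that by (auto simp: s F3_def)
    have "(\<sigma> \<omega>)\<^sup>2 = \<omega>\<^sup>2" using s(4)[of \<omega> \<omega>] by (simp add: power2_eq_square omega s)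
    hence "\<sigma> \<omega> = \<omega> \<or> \<sigma> \<omega> = - \<omega>" by (simp add: power2_eq_iff)
    thus ?thesis
    proof
      assume h: "\<sigma> \<omega> = \<omega>"
      have "\<sigma> x = id x" for x using generates[of x] rep h by auto
      thus ?thesis by blast
    next
      assume h: "\<sigma> \<omega> = - \<omega>"
      have "\<sigma> x = x ^ 3" for x
      proof -
        obtain a b where ab: "a \<in> K" "b \<in> K" "x = a + b * \<omega>" using generates by blast
        hence "x ^ 3 = a + b * - \<omega>"
          using cube_K[of a] cube_K[of b] by (simp add: cube_add power_mult_distrib cube_omega)
        thus ?thesis using ab rep h by simp
      qed
      thus ?thesis by blast
    qed
  qed
  hence "Collect field_automorphism = {id, \<lambda>x :: 'a. x ^ 3}"
    using field_automorphism_id field_automorphism_cube by auto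
  moreover have "id \<noteq> (\<lambda>x :: 'a. x ^ 3)"
  proof
    assume "id = (\<lambda>x :: 'a. x ^ 3)"
    hence "\<omega> = \<omega> ^ 3" by (metis id_apply)
    hence "\<omega> + \<omega> = 0" by (simp add: cube_omega eq_neg_iff_add_eq_0)
    thus False using omega_notin by (simp add: char3 F3_def)
  qed
  ultimately show ?thesis by simp
qed

section \<open>Linear maps preserving the cone\<close>

lemma card_directions: "card directions = 4"
  by (simp add: directions_def char3(6,7))

lemma lin_cone:
  assumes "k \<in> K \<times> K" "l \<in> K \<times> K" "det2 k l \<noteq> 0" "x \<noteq> 0" "z \<in> cone"
  shows "lin (scl x k) (scl x l) z \<in> cone"
proof -
  obtain y m where m: "y \<noteq> 0" "m \<in> directions" "z = scl y m" using cone_decompose[OF assms(5)] .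
  hence mK: "fst m \<in> K" "snd m \<in> K" using directions_F3 by auto
  have eq: "lin (scl x k) (scl x l) z = scl (x * y) (lin k l m)"
    by (simp add: m(3) lin_def scl_def prod_eq_iff algebra_simps)
  have "lin k l m \<in> K \<times> K"
    using assms(1,2) mK unfolding lin_def scl_def mem_Times_iff fst_add snd_add fst_conv snd_conv
    by (blast intro: F3_closed(1,3)[OF three])
  moreover have "det2 (scl x k) (scl x l) \<noteq> 0" using assms by (simp add: det2_def scl_def algebra_simps)
  hence "lin (scl x k) (scl x l) z \<noteq> 0"
    using assms(5) bij_lin by (metis (mono_tags, lifting) bij_is_inj cone_def injD lin_0 mem_Collect_eq)
  ultimately show ?thesis using scl_in_cone eq by metis
qed

text \<open>The maps are the non-zero multiples of invertible matrices over F_3. Scalars 1 and -1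
  lie in both factors, which gives 8 * 48 / 2. Requiring the first column of the F_3-matrix to be a
  chosen direction removes the ambiguity and counts 8 * 4 * 6.\<close>

lemma card_cone_linear:
  "card {u :: ('a \<times> 'a) \<times> 'a \<times> 'a. det2 (fst u) (snd u) \<noteq> 0 \<and> (\<forall>z\<in>cone. lin (fst u) (snd u) z \<in> cone)} = 192"
    (is "card ?U = _")
proof -
  let ?L = "\<lambda>k. K \<times> K - {0, k, - k}"
  let ?P = "(UNIV - {0 :: 'a}) \<times> Sigma directions ?L"
  let ?f = "\<lambda>(x, k, l). (scl x k, scl x l)"
  have inj: "inj_on ?f ?P"
  proof (rule inj_onI)
    fix p q assume p: "p \<in> ?P" and q: "q \<in> ?P" and eq: "?f p = ?f q"
    obtain x k l where p': "p = (x, k, l)" by (cases p) auto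
    obtain y m n where q': "q = (y, m, n)" by (cases q) auto
    have "x = y \<and> k = m" using p q eq directions_scl_eq[of k m x y] by (simp add: p' q')
    thus "p = q" using p eq by (auto simp: p' q' scl_def prod_eq_iff)
  qed
  have "?f ` ?P = ?U"
  proof (intro equalityI subsetI)
    fix u assume "u \<in> ?f ` ?P"
    then obtain p where p: "p \<in> ?P" "u = ?f p" by blast
    obtain x k l where "p = (x, k, l)" by (cases p) auto
    with p have u: "u = (scl x k, scl x l)" "x \<noteq> 0" "k \<in> directions" "l \<in> K \<times> K" "l \<notin> {0, k, - k}"
      by simp_all
    hence "det2 k l \<noteq> 0" using det2_directions by blast
    moreover have "det2 (scl x k) (scl x l) = x * x * det2 k l" by (simp add: det2_def scl_def algebra_simps)
    ultimately show "u \<in> ?U"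
      using lin_cone[of k l x] u directions_F3 by auto
  next
    fix u assume "u \<in> ?U"
    hence det: "det2 (fst u) (snd u) \<noteq> 0" and lin: "\<And>z. z \<in> cone \<Longrightarrow> lin (fst u) (snd u) z \<in> cone" by auto
    \<comment> \<open>The images of the unit vectors give both columns the form scalar times
      direction; the image of (1, 1) then forces the ratio of the two scalars into F_3.\<close>
    have "fst u \<in> cone" "snd u \<in> cone" "fst u + snd u \<in> cone"
      using lin[of "(1,0)"] lin[of "(0,1)"] lin[of "(1,1)"]
      by (simp_all add: cone_def lin_def scl_def zero_prod_def plus_prod_def)
    then obtain x k y l where k: "x \<noteq> 0" "k \<in> directions" "fst u = scl x k"
      and l: "y \<noteq> 0" "l \<in> directions" "snd u = scl y l"
      and w: "wronski (scl x k + scl y l) = 0"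
      by (metis cone_decompose cone_iff_wronski)
    have kl: "k \<in> K \<times> K" "l \<in> K \<times> K" using k l directions_F3 by blast+
    have "det2 (fst u) (snd u) = x * y * det2 k l" by (simp add: k l det2_def scl_def algebra_simps)
    hence d: "det2 k l \<noteq> 0" using det by auto
    hence "x ^ 3 * y - x * y ^ 3 = 0" using w wronski_lincomb[OF kl] by simp
    then obtain a where a: "a \<in> K" "y = a * x" using proportional_K k(1) by blast
    have "a \<noteq> 0" using a l(1) by auto
    have "scl a l \<in> K \<times> K" using a(1) kl(2) unfolding scl_def mem_Times_iff fst_conv snd_conv
      by (blast intro: F3_closed(3)[OF three])
    moreover have "det2 k (scl a l) = a * det2 k l" by (simp add: det2_def scl_def algebra_simps)
    hence "det2 k (scl a l) \<noteq> 0" using d \<open>a \<noteq> 0\<close> by simp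
    ultimately have mem: "scl a l \<in> ?L k" using det2_directions[OF k(2)] by simp
    have "u = (fst u, snd u)" by simp
    also have "\<dots> = ?f (x, k, scl a l)" by (simp only: k l a prod.case) (simp add: scl_def)
    finally show "u \<in> ?f ` ?P"
      by (rule image_eqI) (use k mem in \<open>simp del: Diff_insert\<close>)
  qed
  hence "card ?U = card ?P" using card_image[OF inj] by (simp only:)
  moreover have "card (?L k) = 6" if "k \<in> directions" for k
  proof -
    have "{0, k, - k} \<subseteq> K \<times> K" "card {0, k, - k} = 3"
      using that by (auto simp: directions_def zero_prod_def F3_def char3(6,7))
    thus ?thesis by (simp add: card_Diff_subset card_cartesian_product card_F3[OF three] finite_F3 del: Diff_insert)
  qed
  ultimately show ?thesis
    by (simp add: card_cartesian_product card9 card_directions card_Diff_singleton)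
qed

text \<open>The frame vectors have two of the four non-integral slopes, 1 + \<open>\<omega>\<close>
  and its negative. The extra factor \<open>\<omega>\<close> in the second makes their sum and
  difference take the remaining slopes 1 - \<open>\<omega>\<close> and \<open>\<omega>\<close> -
  1.\<close>

lemma frame_det: "det2 (1, 1 + \<omega>) (\<omega>, - (\<omega> * (1 + \<omega>))) \<noteq> 0"
proof -
  have "det2 (1, 1 + \<omega>) (\<omega>, - (\<omega> * (1 + \<omega>))) = \<omega> * (1 + \<omega>) - 3 * (\<omega> * (1 + \<omega>))"
    by (simp add: det2_def algebra_simps)
  thus ?thesis using omega_neq by (simp add: three add_eq_0_iff)
qed

lemma squares_scale:
  fixes x y :: "'b::field"
  assumes "y \<noteq> 0" shows "x * y\<^sup>2 \<in> squares \<longleftrightarrow> x \<in> squares"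
proof
  have sq: "y\<^sup>2 \<in> squares" "(1 / y)\<^sup>2 \<in> squares" by (auto simp: squares_def)
  {
    assume "x * y\<^sup>2 \<in> squares"
    from squares_mult[OF this sq(2)] show "x \<in> squares"
      using assms by (simp add: power_divide)
  }
  {
    assume "x \<in> squares"
    from squares_mult[OF this sq(1)] show "x * y\<^sup>2 \<in> squares" .
  }
qed

text \<open>In the basis 1, \<open>\<omega>\<close> every square has a vanishing coordinate, and
  these two elements have none.\<close>

lemma nonsquare_GF9: "1 - \<omega> \<notin> squares" "\<omega> - 1 \<notin> squares"
proof -
  have "1 - \<omega> \<noteq> c" "\<omega> - 1 \<noteq> c" if "c \<in> {0, 1, - 1, \<omega>, - \<omega>}" for c
  proof -
    have one: "0 \<in> K" "1 \<in> K" "- 1 \<in> K" by (simp_all add: F3_def)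
    have "c = 0 + 0 * \<omega> \<or> c = 1 + 0 * \<omega> \<or> c = - 1 + 0 * \<omega> \<or> c = 0 + 1 * \<omega> \<or> c = 0 + - 1 * \<omega>"
      using that by auto
    then obtain a b where ab: "a \<in> K" "b \<in> K" "c = a + b * \<omega>" "a = 0 \<or> b = 0"
      using one by blast
    show "1 - \<omega> \<noteq> c"
      using omega_lincomb_eq_0[of "1 - a" "- 1 - b"] F3_closed(2)[OF three one(2) ab(1)]
        F3_closed(2)[OF three one(3) ab(2)] ab(3,4) by (auto simp: algebra_simps)
    show "\<omega> - 1 \<noteq> c"
      using omega_lincomb_eq_0[of "- 1 - a" "1 - b"] F3_closed(2)[OF three one(3) ab(1)]
        F3_closed(2)[OF three one(2) ab(2)] ab(3,4) by (auto simp: algebra_simps)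
  qed
  thus "1 - \<omega> \<notin> squares" "\<omega> - 1 \<notin> squares" unfolding squares_GF9 by blast+
qed

text \<open>The norm in the adapted frame, dehomogenised with m = s / t. On F_3 the polynomial takes
  only the values 1 and -1, leaving a non-square.\<close>

lemma square_values_GF9: "(1 - \<omega>) * (m\<^sup>2 + m - 1) \<in> squares \<longleftrightarrow> m \<notin> K"
proof -
  obtain a b where ab: "a \<in> K" "b \<in> K" and m: "m = a + b * \<omega>" using generates by blast
  show ?thesis
  proof (cases "b = 0")
    case True
    thus ?thesis using ab nonsquare_GF9 by (auto simp: m F3_def)
  next
    case False
    hence "m \<notin> K"
      using omega_lincomb_eq_0[OF F3_closed(2)[OF three ab(1)] ab(2), of m] by (auto simp: m algebra_simps)
    moreover have "(1 - \<omega>) * (m\<^sup>2 + m - 1) \<in> {0, 1, - 1, \<omega>, - \<omega>}"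
      using ab False by (auto simp: m F3_def power2_eq_square algebra_simps omega omega_power2 char3)
    ultimately show ?thesis by (simp add: squares_GF9)
  qed
qed

text \<open>
  The non-integral directions of the plane have the four slopes \<open>\<plusminus>1 \<plusminus> \<omega>\<close>, a Baer subline; the frame below is
  chosen such that it becomes the projective line over \<open>F\<^sub>3\<close>.
\<close>

lemma cone_gnorm:
  "z \<in> cone \<longleftrightarrow> gnorm (lin (1, 1 + \<omega>) (\<omega>, - (\<omega> * (1 + \<omega>))) z) \<notin> squares"
proof -
  obtain s t where z: "z = (s, t)" by (cases z)
  have "gnorm (lin (1, 1 + \<omega>) (\<omega>, - (\<omega> * (1 + \<omega>))) z) = (s + t * \<omega>)\<^sup>2 + (s * (1 + \<omega>) - t * (\<omega> * (1 + \<omega>)))\<^sup>2"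
    by (simp add: z gnorm_def lin_def scl_def)
  \<comment> \<open>The explicit multiple of 3 makes this an identity that follows from the equation
    for \<open>\<omega>\<close> alone.\<close>
  also have "\<dots> = (1 - \<omega>) * (s\<^sup>2 + s * t - t\<^sup>2) + 3 * (\<omega> * s * t + \<omega> * s\<^sup>2 + s * t - \<omega> * t\<^sup>2)"
    using omega by algebra
  finally have N: "gnorm (lin (1, 1 + \<omega>) (\<omega>, - (\<omega> * (1 + \<omega>))) z) = (1 - \<omega>) * (s\<^sup>2 + s * t - t\<^sup>2)"
    by (simp add: three)
  show ?thesis
  proof (cases "t = 0")
    case True
    thus ?thesis unfolding N using squares_scale[of s "1 - \<omega>"] nonsquare_GF9
      by (cases "s = 0") (auto simp: z cone_def zero_prod_def squares_def)
  next
    case False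
    have "(1 - \<omega>) * (s\<^sup>2 + s * t - t\<^sup>2) = (1 - \<omega>) * ((s / t)\<^sup>2 + s / t - 1) * t\<^sup>2"
      using False by (simp add: power_divide field_simps power2_eq_square)
    hence "(1 - \<omega>) * (s\<^sup>2 + s * t - t\<^sup>2) \<in> squares \<longleftrightarrow> s / t \<notin> K"
      using squares_scale[OF False] square_values_GF9 by metis
    thus ?thesis unfolding N using False
      by (auto simp: z cone_def zero_prod_def F3_def divide_eq_eq)
  qed
qed

theorem affine_automorphism_groups_GF9:
  "card (AffAut_set :: ('a \<times> 'a \<Rightarrow> 'a \<times> 'a) set) = 31104"
  "group_index (AffAut_group :: ('a \<times> 'a \<Rightarrow> 'a \<times> 'a) monoid) G_set = 3"
proof -
  have "map_prod \<sigma> \<sigma> z \<in> cone \<longleftrightarrow> z \<in> cone" if "field_automorphism \<sigma>" for \<sigma> and z :: "'a \<times> 'a"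
    using field_automorphism_simps(5)[OF that, of "snd z"] field_automorphism_simps(7)[OF that, of "fst z" "- snd z"]
    by (cases z) (simp add: cone_def zero_prod_def field_automorphism_simps[OF that])
  from card_line_preserving[OF this]
  show Aff: "card (AffAut_set :: ('a \<times> 'a \<Rightarrow> 'a \<times> 'a) set) = 31104"
    by (simp add: card_AffAut_set[OF frame_det cone_gnorm] card_cone_linear field_automorphisms_GF9 card9 card_cartesian_product)
  have "(2::'a) \<noteq> 0" by (simp add: char3(1))
  hence "card (G_set :: ('a \<times> 'a \<Rightarrow> 'a \<times> 'a) set) = 10368"
    using card_gnorm_square[OF omega]
    by (simp add: card_G_set field_automorphisms_GF9 card9 card_squares_GF9 card_cartesian_product)
  thus "group_index (AffAut_group :: ('a \<times> 'a \<Rightarrow> 'a \<times> 'a) monoid) G_set = 3"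
    using group_index_G_set[where 'a = 'a] by (simp add: Aff)
qed

subsection \<open>Rigidity of the integral automorphisms\<close>

abbreviation Aut9 :: "('a \<times> 'a \<Rightarrow> 'a \<times> 'a) set" where "Aut9 \<equiv> diff_preserving cone"

abbreviation "e11 \<equiv> (1 :: 'a, 0 :: 'a)"
abbreviation "e12 \<equiv> (0 :: 'a, 1 :: 'a)"
abbreviation "e21 \<equiv> (\<omega>, 0 :: 'a)"
abbreviation "e22 \<equiv> (0 :: 'a, \<omega>)"

lemma cube_cube: "(x ^ 3) ^ 3 = x" for x :: 'a
proof -
  obtain a b where ab: "a \<in> K" "b \<in> K" "x = a + b * \<omega>" using generates by blast
  thus ?thesis using cube_K[of a] cube_K[of b]
    by (simp add: cube_add power_mult_distrib cube_omega cube_diff)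
qed

lemma power_9: "x ^ 9 = x" for x :: 'a
proof -
  have "x ^ 9 = (x ^ 3) ^ 3" by (simp flip: power_mult)
  thus ?thesis by (simp only: cube_cube)
qed

lemma cube_uminus: "(- x) ^ 3 = - (x ^ 3)" for x :: 'a
  by (simp add: power3_eq_cube)

lemma add_self_eq_0: "x + x = 0 \<longleftrightarrow> x = 0" for x :: 'a
  by (simp add: char3(4))

text \<open>\<open>wronski\<close> and its polar form take values in this set only, so a non-zero
  value is merely a sign.\<close>

lemma anti_fixed_iff: "v ^ 3 = - v \<longleftrightarrow> v \<in> {0, \<omega>, - \<omega>}" for v :: 'a
proof
  assume v: "v ^ 3 = - v"
  have "v * (v * v - \<omega> * \<omega>) = 0" using v by (simp add: power3_eq_cube algebra_simps omega)
  hence "v = 0 \<or> v * v = \<omega> * \<omega>" by simp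
  thus "v \<in> {0, \<omega>, - \<omega>}" by (auto simp: square_eq_iff)
qed (auto simp: cube_omega)

lemma wronski_anti_fixed: "wronski z ^ 3 = - wronski z" for z :: "'a \<times> 'a"
  by (simp add: wronski_def cube_diff power_mult_distrib power_9)

text \<open>The polar form of \<open>wronski\<close>, regarded as a quadratic form over F_3.\<close>

definition wbil :: "'a \<times> 'a \<Rightarrow> 'a \<times> 'a \<Rightarrow> 'a" where
  "wbil z w = fst z ^ 3 * snd w + fst w ^ 3 * snd z - fst z * snd w ^ 3 - fst w * snd z ^ 3"

lemma wbil_anti_fixed: "wbil z w ^ 3 = - wbil z w"
  by (simp add: wbil_def cube_diff cube_add power_mult_distrib power_9)

lemma wronski_diff: "wronski (z - w) = wronski z + wronski w - wbil z w" for z w :: "'a \<times> 'a"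
  by (simp add: wronski_def wbil_def cube_diff algebra_simps)

lemma wronski_add: "wronski (z + w) = wronski z + wronski w + wbil z w" for z w :: "'a \<times> 'a"
  by (simp add: wronski_def wbil_def cube_add algebra_simps)

lemma wronski_uminus: "wronski (- z) = wronski z"
  by (simp add: wronski_def power3_eq_cube)

lemma wbil_add: "wbil z (w + w') = wbil z w + wbil z w'"
  and wbil_diff: "wbil z (w - w') = wbil z w - wbil z w'"
  and wbil_uminus: "wbil z (- w) = - wbil z w"
  by (simp_all add: wbil_def cube_add cube_diff cube_uminus algebra_simps)

lemma wbil_frame:
  "wbil z e11 = snd z - snd z ^ 3" "wbil z e12 = fst z ^ 3 - fst z"
  "wbil z e21 = - (\<omega> * (snd z + snd z ^ 3))" "wbil z e22 = \<omega> * (fst z ^ 3 + fst z)"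
  by (simp_all add: wbil_def cube_omega algebra_simps)

text \<open>Nondegeneracy: up to unit factors, pairing with the frame gives c - c^3 and c + c^3 for
  each coordinate c, and their sum 2 c determines c.\<close>

lemma wbil_frame_eqD:
  assumes "\<And>e. e \<in> {e11, e12, e21, e22} \<Longrightarrow> wbil z e = wbil w e" shows "z = w"
proof -
  have eq: "a = b" if "a - a ^ 3 = b - b ^ 3" "a + a ^ 3 = b + b ^ 3" for a b :: 'a
  proof -
    have "(a - b) + (a - b) = ((a - a ^ 3) - (b - b ^ 3)) + ((a + a ^ 3) - (b + b ^ 3))" by simp
    also have "\<dots> = 0" using that by simp
    finally show ?thesis by (simp only: add_self_eq_0) simp
  qed
  have "wbil z e11 = wbil w e11" "wbil z e12 = wbil w e12" "wbil z e21 = wbil w e21" "wbil z e22 = wbil w e22"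
    using assms by simp_all
  hence "snd z - snd z ^ 3 = snd w - snd w ^ 3" "snd z + snd z ^ 3 = snd w + snd w ^ 3"
    "fst z ^ 3 - fst z = fst w ^ 3 - fst w" "fst z ^ 3 + fst z = fst w ^ 3 + fst w"
    using omega_neq(1) by (simp_all add: wbil_frame)
  note d = this
  have "fst z - fst z ^ 3 = fst w - fst w ^ 3" using d(3) by (metis minus_diff_eq)
  moreover have "fst z + fst z ^ 3 = fst w + fst w ^ 3" using d(4) by (simp only: add.commute)
  ultimately have "fst z = fst w" by (rule eq)
  moreover have "snd z = snd w" by (rule eq[OF d(1,2)])
  ultimately
  show ?thesis by (simp add: prod_eq_iff)
qed

lemma Aut9_wronski:
  assumes "h \<in> Aut9" shows "wronski (h z - h w) = 0 \<longleftrightarrow> wronski (z - w) = 0"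
proof -
  have "wronski 0 = 0" by (simp add: wronski_def)
  moreover have "h z - h w = 0 \<longleftrightarrow> z - w = 0"
    using assms by (auto simp: diff_preserving_def bij_is_inj inj_eq)
  ultimately show ?thesis using diff_preserving_iff[OF assms, of z w] unfolding cone_iff_wronski by metis
qed

lemma wronski_frame: "wronski e11 = 0" "wronski e12 = 0" "wronski e21 = 0" "wronski e22 = 0"
  by (simp_all add: wronski_def)

text \<open>
  The third point \<open>- q\<close> of the \<open>F\<^sub>3\<close>-line through \<open>0\<close> and \<open>q\<close> is determined by the graph alone: it is the
  only common neighbour of \<open>0\<close> and \<open>q\<close> that is adjacent to all the other ones.
\<close>

definition third_point :: "'a \<times> 'a \<Rightarrow> 'a \<times> 'a \<Rightarrow> bool" where
  "third_point q r \<longleftrightarrow> r \<in> cone \<and> r - q \<in> cone \<and> (\<forall>x. x \<in> cone \<and> x - q \<in> cone \<and> x \<noteq> r \<longrightarrow> x - r \<in> cone)"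

text \<open>Recentring \<open>h\<close> at \<open>p\<close> gives a bijection fixing 0 that
  preserves and reflects adjacency, and the defining condition quantifies over all points.\<close>

lemma third_point_transfer:
  assumes h: "h \<in> Aut9"
  shows "third_point (h (p + q) - h p) (h (p + r) - h p) \<longleftrightarrow> third_point q r"
proof -
  let ?h = "\<lambda>x. h (p + x) - h p"
  have iff: "?h x - ?h y \<in> cone \<longleftrightarrow> x - y \<in> cone" "?h x \<in> cone \<longleftrightarrow> x \<in> cone" for x y
    using diff_preserving_iff[OF h, of "p + x" "p + y"] diff_preserving_iff[OF h, of "p + x" p] by simp_all
  have bij: "bij h" using h by (simp add: diff_preserving_def)
  have eq: "?h x = ?h y \<longleftrightarrow> x = y" for x y using bij by (simp add: bij_is_inj inj_eq)
  have surj: "\<exists>x. y = ?h x" for y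
  proof -
    obtain z where "y + h p = h z" using bij by (metis bij_pointE)
    hence "y = ?h (z - p)" by (simp add: algebra_simps)
    thus ?thesis ..
  qed
  have "(\<forall>y. y \<in> cone \<and> y - ?h q \<in> cone \<and> y \<noteq> ?h r \<longrightarrow> y - ?h r \<in> cone) \<longleftrightarrow>
    (\<forall>x. x \<in> cone \<and> x - q \<in> cone \<and> x \<noteq> r \<longrightarrow> x - r \<in> cone)" (is "?L \<longleftrightarrow> ?R")
  proof
    assume L: ?L
    show ?R
    proof
      fix x show "x \<in> cone \<and> x - q \<in> cone \<and> x \<noteq> r \<longrightarrow> x - r \<in> cone"
        using L[rule_format, of "?h x"] unfolding iff eq by blast
    qed
  next
    assume R: ?R
    show ?L
    proof
      fix y
      obtain x where "y = ?h x" using surj by blast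
      thus "y \<in> cone \<and> y - ?h q \<in> cone \<and> y \<noteq> ?h r \<longrightarrow> y - ?h r \<in> cone"
        using R by (simp only: iff eq) blast
    qed
  qed
  thus ?thesis unfolding third_point_def iff by simp
qed

text \<open>A common neighbour x of 0 and \<open>e11\<close> has \<open>wronski x\<close> and
  \<open>wbil x e11\<close> both zero, so x + \<open>e11\<close> is isotropic as well. Conversely,
  testing \<open>r\<close> against \<open>e11\<close> and the common neighbours \<open>e12\<close>
  and \<open>e21\<close> gives polar equations that leave only F_3-multiples of
  \<open>e11\<close>.\<close>

lemma third_point_e11: "third_point e11 r \<longleftrightarrow> r = - e11"
proof
  assume r: "r = - e11"
  have "x - r \<in> cone" if x: "x \<in> cone" "x - e11 \<in> cone" "x \<noteq> r" for x
  proof -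
    have "wbil x e11 = 0" using x(1,2) wronski_diff[of x e11] unfolding cone_iff_wronski wronski_frame by auto
    moreover have "x - r \<noteq> 0" using x(3) by simp
    ultimately show ?thesis using x(1) wronski_add[of x e11] unfolding r diff_minus_eq_add cone_iff_wronski wronski_frame by auto
  qed
  moreover have "r \<in> cone" "r - e11 \<in> cone"
    by (simp_all add: r cone_def zero_prod_def char3(1))
  ultimately show "third_point e11 r" by (auto simp: third_point_def)
next
  assume t: "third_point e11 r"
  obtain s u where r: "r = (s, u)" by (cases r)
  have W: "wronski r = 0" and nz: "r \<noteq> 0" "r \<noteq> e11" and 11: "wronski (r - e11) = 0"
    using t by (auto simp: third_point_def cone_iff_wronski)
  have x: "x \<noteq> r \<Longrightarrow> wronski (x - r) = 0" if "x \<in> cone" "x - e11 \<in> cone" for x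
    using t that unfolding third_point_def cone_iff_wronski by blast
  have "wbil r e11 = 0" using W 11 wronski_diff[of r e11] unfolding wronski_frame by auto
  hence u: "u ^ 3 = u" by (simp add: wbil_frame r)
  have "wronski (e12 - r) = 0"
    using x[of e12] by (cases "e12 = r") (simp_all add: cone_def zero_prod_def wronski_def)
  hence "wbil r e12 = 0" using W wronski_diff[of r e12] wronski_uminus[of "r - e12"] unfolding wronski_frame minus_diff_eq by auto
  hence s: "s ^ 3 = s" by (simp add: wbil_frame r)
  have "e21 \<noteq> r" using s cube_omega omega_neq by (auto simp: r)
  hence "wronski (e21 - r) = 0"
    using x[of e21] omega_neq by (simp add: cone_def zero_prod_def)
  hence "wbil r e21 = 0" using W wronski_diff[of r e21] wronski_uminus[of "r - e21"] unfolding wronski_frame minus_diff_eq by auto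
  hence u0: "u = 0" using omega_neq(1) by (simp add: wbil_frame r u add_self_eq_0 char3(1))
  have "s * (s * s - 1) = 0" using s by (simp add: power3_eq_cube algebra_simps)
  hence "s = 0 \<or> s = 1 \<or> s = - 1" by (auto simp: square_eq_1_iff)
  thus "r = - e11" using nz u0 by (auto simp: r zero_prod_def)
qed

section \<open>Coordinates over F_3, transposition and tensor products of linear maps\<close>

definition re :: "'a \<Rightarrow> 'a" where "re x = - (x + x ^ 3)"
definition im :: "'a \<Rightarrow> 'a" where "im x = (x - x ^ 3) * \<omega>"

text \<open>Cubing is the conjugation of F_9 over F_3, and 2 = -1 replaces the halving in the usual
  formulas for real and imaginary parts.\<close>

lemma re_im_lincomb:
  assumes "a \<in> K" "b \<in> K" shows "re (a + b * \<omega>) = a" "im (a + b * \<omega>) = b"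
  using cube_K[OF assms(1)] cube_K[OF assms(2)]
  by (simp_all add: re_def im_def cube_add power_mult_distrib cube_omega algebra_simps omega omega_power2(2) char3(4,5))

lemma re_im: "x = re x + im x * \<omega>" "re x \<in> K" "im x \<in> K"
proof -
  obtain a b where ab: "a \<in> K" "b \<in> K" "x = a + b * \<omega>" using generates by blast
  thus "x = re x + im x * \<omega>" "re x \<in> K" "im x \<in> K" using re_im_lincomb by simp_all
qed

lemma re_im_linear:
  "re (x - y) = re x - re y" "im (x - y) = im x - im y"
  "k \<in> K \<Longrightarrow> re (k * x) = k * re x" "k \<in> K \<Longrightarrow> im (k * x) = k * im x"
  using cube_K[of k] by (simp_all add: re_def im_def cube_diff power_mult_distrib algebra_simps)

text \<open>Matrix transposition, if \<open>(a + b \<omega>, c + d \<omega>)\<close> is read as the matrix with entries \<open>a, b, c, d\<close>.\<close>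

definition transposition :: "'a \<times> 'a \<Rightarrow> 'a \<times> 'a" where
  "transposition z = (re (fst z) + re (snd z) * \<omega>, im (fst z) + im (snd z) * \<omega>)"

lemma transposition_diff: "transposition (z - w) = transposition z - transposition w"
  by (simp add: transposition_def re_im_linear algebra_simps)

text \<open>Transposing a rank one matrix exchanges its factors: the F_3-vector \<open>k\<close>
  becomes the scalar, and the coordinates of the scalar \<open>x\<close> become the
  F_3-vector.\<close>

lemma transposition_Aut9: "transposition \<in> Aut9"
proof -
  have inv: "transposition (transposition z) = z" for z
    using re_im re_im_lincomb by (simp add: transposition_def prod_eq_iff)
  hence bij: "bij transposition" by (intro o_bij[of transposition]) (simp_all add: fun_eq_iff)
  have "transposition z \<in> cone" if z: "z \<in> cone" for z
  proof -
    obtain x k where xk: "x \<noteq> 0" "k \<in> directions" "z = scl x k" using cone_decompose[OF z] .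
    have k: "fst k \<in> K" "snd k \<in> K" using xk(2) directions_F3 by auto
    have eq: "transposition z = scl (fst k + snd k * \<omega>) (re x, im x)"
      using re_im_linear(3)[OF k(1), of x] re_im_linear(3)[OF k(2), of x]
        re_im_linear(4)[OF k(1), of x] re_im_linear(4)[OF k(2), of x]
      by (simp add: xk(3) transposition_def scl_def algebra_simps)
    moreover have "transposition 0 = 0" using transposition_diff[of 0 0] by simp
    hence "transposition z \<noteq> 0" using inv[of z] z by (auto simp: cone_def)
    ultimately show ?thesis using scl_in_cone[of "(re x, im x)"] re_im by simp
  qed
  thus ?thesis using bij by (simp add: diff_preserving_def transposition_diff[symmetric] del: split_paired_All)
qed

text \<open>
  The map \<open>P \<otimes> Q\<close> on \<open>F\<^sub>9 \<otimes> F\<^sub>3\<^sup>2\<close>, where \<open>P\<close> is the \<open>F\<^sub>3\<close>-linear map sending \<open>1, \<omega>\<close> to \<open>x, y\<close> and \<open>Q\<close> sends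
  the unit vectors to \<open>k, l\<close>.
\<close>

definition tensor :: "'a \<Rightarrow> 'a \<Rightarrow> 'a \<times> 'a \<Rightarrow> 'a \<times> 'a \<Rightarrow> 'a \<times> 'a \<Rightarrow> 'a \<times> 'a" where
  "tensor x y k l z = (let P = \<lambda>c. re c * x + im c * y in map_prod P P (lin k l z))"

lemma re_im_frame: "c \<in> K \<Longrightarrow> re c = c" "c \<in> K \<Longrightarrow> im c = 0"
  "c \<in> K \<Longrightarrow> re (\<omega> * c) = 0" "c \<in> K \<Longrightarrow> im (\<omega> * c) = c"
proof -
  have 0: "0 \<in> K" by (simp add: F3_def)
  show "re c = c" "im c = 0" if "c \<in> K"
    using re_im_lincomb[OF that 0] by simp_all
  show "re (\<omega> * c) = 0" "im (\<omega> * c) = c" if "c \<in> K"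
    using re_im_lincomb[OF 0 that] by (simp_all add: mult.commute[of c])
qed

lemma tensor_frame:
  assumes "k \<in> K \<times> K" "l \<in> K \<times> K"
  shows "tensor x y k l e11 = scl x k" "tensor x y k l e22 = scl y l"
    "tensor x y k l e12 = scl x l" "tensor x y k l e21 = scl y k"
proof -
  obtain a b c d where kl: "k = (a, b)" "l = (c, d)" and K: "a \<in> K" "b \<in> K" "c \<in> K" "d \<in> K"
    using assms by auto
  note re_im_frame[OF K(1), simp] re_im_frame[OF K(2), simp] re_im_frame[OF K(3), simp] re_im_frame[OF K(4), simp]
  show "tensor x y k l e11 = scl x k" "tensor x y k l e22 = scl y l"
    "tensor x y k l e12 = scl x l" "tensor x y k l e21 = scl y k"
    by (simp_all add: kl tensor_def lin_def scl_def mult.commute)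
qed

lemma tensor_diff: "tensor x y k l (z - w) = tensor x y k l z - tensor x y k l w"
  by (rule prod_eqI) (simp_all add: tensor_def Let_def lin_diff re_im_linear left_diff_distrib)

text \<open>A product of factors goes to the product of their images, so rank one is kept. The
  condition on \<open>y\<close> says that \<open>x\<close> and \<open>y\<close> are independent over
  F_3, which makes the scalar factor of the map injective.\<close>

lemma tensor_Aut9:
  assumes kl: "k \<in> K \<times> K" "l \<in> K \<times> K" "det2 k l \<noteq> 0" and xy: "x \<noteq> 0" "y \<notin> {0, x, - x}"
  shows "tensor x y k l \<in> Aut9"
proof -
  define P where "P c = re c * x + im c * y" for c
  have T: "tensor x y k l z = map_prod P P (lin k l z)" for z
    by (simp add: tensor_def Let_def P_def[abs_def])
  have P_scl: "P (a * c) = P c * a" if "a \<in> K" for a c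
    unfolding P_def re_im_linear(3,4)[OF that] by (simp add: algebra_simps)
  have P0: "c = 0" if "P c = 0" for c
  proof -
    have "re c \<in> {0, 1, - 1}" "im c \<in> {0, 1, - 1}" using re_im by (simp_all add: F3_def)
    hence "re c = 0 \<and> im c = 0" using that xy by (auto simp: P_def add_eq_0_iff)
    thus ?thesis using re_im(1)[of c] by simp
  qed
  have "inj P"
  proof (rule injI)
    fix c d assume "P c = P d"
    hence "P (c - d) = 0" by (simp add: P_def re_im_linear algebra_simps)
    thus "c = d" using P0[of "c - d"] by simp
  qed
  hence "bij P" by (simp add: bij_def finite_UNIV_inj_surj)
  hence "bij (map_prod P P)" by (simp add: bij_def prod.inj_map map_prod_surj)
  moreover have "tensor x y k l = map_prod P P \<circ> lin k l" by (simp add: fun_eq_iff T del: split_paired_All)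
  ultimately have bij: "bij (tensor x y k l)" using bij_lin[OF kl(3)] by (simp add: bij_comp)
  have "tensor x y k l z \<in> cone" if z: "z \<in> cone" for z
  proof -
    have "lin (scl 1 k) (scl 1 l) z \<in> cone" by (rule lin_cone) (use kl z in simp_all)
    then obtain c m where cm: "c \<noteq> 0" "m \<in> directions" "lin k l z = scl c m"
      unfolding scl_1 by (rule cone_decompose)
    have m: "fst m \<in> K" "snd m \<in> K" "m \<in> K \<times> K" using cm(2) directions_F3 by auto
    have eq: "tensor x y k l z = scl (P c) m"
      using P_scl[OF m(1), of c] P_scl[OF m(2), of c] by (simp add: T cm(3) scl_def mult.commute)
    moreover have "P c \<noteq> 0" using P0 cm(1) by blast
    moreover have "m \<noteq> 0" using cm(2) by (auto simp: directions_def zero_prod_def)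
    ultimately have "scl (P c) m \<noteq> 0" by (auto simp: scl_def prod_eq_iff)
    thus ?thesis using scl_in_cone[OF m(3)] eq by simp
  qed
  thus ?thesis using bij by (simp add: diff_preserving_def tensor_diff[symmetric] del: split_paired_All)
qed

text \<open>Reduces to \<open>e11\<close>: completing \<open>x\<close> by
  \<open>x * \<omega>\<close> and \<open>k\<close> by \<open>l\<close> to F_3-bases gives a tensor
  automorphism fixing 0 that takes \<open>e11\<close> to \<open>q\<close> and its negative to
  \<open>- q\<close>.\<close>

lemma third_point_iff:
  assumes q: "q \<in> cone" shows "third_point q r \<longleftrightarrow> r = - q"
proof -
  obtain x k where xk: "x \<noteq> 0" "k \<in> directions" "q = scl x k" using cone_decompose[OF q] .
  have xo: "x * \<omega> \<notin> {0, x, - x}" using xk(1) omega_neq mult_left_cancel[of x \<omega> 1] mult_left_cancel[of x \<omega> "- 1"] by simp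
  define l where "l = (if k = (1, 0) then (0, 1) else (1, 0) :: 'a \<times> 'a)"
  have l: "det2 k l \<noteq> 0" "l \<in> K \<times> K" using xk(2) by (auto simp: l_def directions_def det2_def F3_def)
  have k: "k \<in> K \<times> K" using xk(2) directions_F3 by blast
  let ?f = "tensor x (x * \<omega>) k l"
  have f: "?f \<in> Aut9" by (rule tensor_Aut9[OF k l(2,1) xk(1) xo])
  have f0: "?f 0 = 0" using tensor_diff[of x "x * \<omega>" k l 0 0] by simp
  have neg: "?f (- e11) = - q" using tensor_diff[of x "x * \<omega>" k l 0 e11] tensor_frame(1)[OF k l(2)] f0 xk(3) by simp
  have bij: "bij ?f" using f by (simp add: diff_preserving_def)
  obtain r' where r': "r = ?f r'" using bij by (metis bij_pointE)
  have "third_point q r \<longleftrightarrow> third_point e11 r'"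
    using third_point_transfer[OF f, of 0 e11 r'] tensor_frame(1)[OF k l(2)] by (simp add: f0 r' xk(3))
  also have "\<dots> \<longleftrightarrow> r = - q" unfolding third_point_e11 r' neg[symmetric] using bij by (simp add: bij_is_inj inj_eq)
  finally show ?thesis .
qed

lemma Aut9_third_point:
  assumes h: "h \<in> Aut9" and q: "q \<in> cone"
  shows "h (p - q) - h p = - (h (p + q) - h p)"
proof -
  have c: "h (p + q) - h p \<in> cone" using diff_preserving_iff[OF h, of "p + q" p] q by simp
  have "third_point q (- q)" using third_point_iff[OF q] by simp
  hence "third_point (h (p + q) - h p) (h (p - q) - h p)"
    using third_point_transfer[OF h, of p q "- q"] by simp
  thus ?thesis unfolding third_point_iff[OF c] .
qed

text \<open>The ratio b / v is 0, 1 or -1, and the two tests identify it. The primed pair has the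
  same ratio, hence agrees with the first up to one common sign.\<close>

lemma sign_dichotomy:
  assumes "v \<in> {\<omega>, - \<omega>}" "v' \<in> {\<omega>, - \<omega>}" "b \<in> {0, \<omega>, - \<omega>}" "b' \<in> {0, \<omega>, - \<omega>}"
    and "v = b \<longleftrightarrow> v' = b'" "v = - b \<longleftrightarrow> v' = - b'"
  shows "v' = v \<and> b' = b \<or> v' = - v \<and> b' = - b"
  using assms by (auto simp: omega_neq)

lemma two_neq_0: "(2::'a) \<noteq> 0"
  by (simp add: char3(1))

lemma reflect_char3: "p - (q - p) = - p - q" for p q :: "'a \<times> 'a"
proof -
  have "x - (y - x) = 3 * x + (- x - y)" for x y :: 'a by (simp add: algebra_simps)
  thus ?thesis by (simp add: three prod_eq_iff)
qed

text \<open>In characteristic 3 the three points of an F_3-line sum to zero, so the third point on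
  the line through \<open>p\<close> and \<open>q\<close> is \<open>- p - q\<close>.\<close>

lemma Aut9_isotropic_line:
  assumes h: "h \<in> Aut9" and pq: "q - p \<in> cone" shows "h (- p - q) = - h p - h q"
proof -
  have "h (p - (q - p)) - h p = - (h q - h p)" using Aut9_third_point[OF h pq, of p] by simp
  hence "h (p - (q - p)) = h p - (h q - h p)" by (simp add: algebra_simps)
  thus ?thesis by (simp only: reflect_char3)
qed

text \<open>The fourth matrix unit is fixed first. For anisotropic y, adjacency to the frame and its
  negatives then determines the polar values with the frame up to a common sign. For isotropic y
  these tests show only whether the polar values vanish, so y is compared with the anisotropic
  points, by then known to be fixed.\<close>

lemma Aut9_rigid:
  assumes h: "h \<in> Aut9" and h0: "h 0 = 0" and h11: "h e11 = e11" and h22: "h e22 = e22" and h12: "h e12 = e12"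
  shows "h = id"
proof -
  have inj: "h z = h w \<longleftrightarrow> z = w" for z w using h by (auto simp: diff_preserving_def bij_is_inj inj_eq)
  have neg: "h (- q) = - h q" if "q \<in> cone" for q
    using Aut9_third_point[OF h that, of 0] by (simp add: h0)
  have cone_frame: "e11 \<in> cone" "e12 \<in> cone" "e21 \<in> cone" "e22 \<in> cone"
    using omega_neq by (simp_all add: cone_def zero_prod_def)
  have W0: "wronski (h z) = 0 \<longleftrightarrow> wronski z = 0" for z
    using Aut9_wronski[OF h, of z 0] by (simp add: h0)
  \<comment> \<open>Adjacency of \<open>e21\<close> to 0, \<open>e11\<close> and \<open>e22\<close>
    leaves only F_3-multiples of \<open>e21\<close> and \<open>e12\<close> for its image; those of
    \<open>e12\<close> are already taken, so only the sign of \<open>e21\<close> remains.\<close>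
  have h21: "h e21 = e21"
  proof -
    obtain s t where r: "h e21 = (s, t)" by (cases "h e21")
    have W: "wronski (s, t) = 0" using W0[of e21] by (simp add: r wronski_frame)
    have "wronski (h e21 - e11) = 0" "wronski (h e21 - e22) = 0"
      using Aut9_wronski[OF h, of e21 e11] Aut9_wronski[OF h, of e21 e22]
      by (simp_all add: h11 h22) (simp_all add: wronski_def cube_omega cube_uminus)
    hence "wbil (s, t) e11 = 0" "wbil (s, t) e22 = 0"
      using W wronski_diff[of "(s, t)" e11] wronski_diff[of "(s, t)" e22] unfolding r wronski_frame by auto
    hence "t - t ^ 3 = 0" "s ^ 3 + s = 0"
      using omega_neq(1) by (simp_all add: wbil_frame)
    hence t: "t ^ 3 = t" and s: "s ^ 3 = - s"
      by (simp_all only: right_minus_eq eq_neg_iff_add_eq_0)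
    have "wronski (s, t) = - (s * t + s * t)" by (simp add: wronski_def s t)
    hence "s = 0 \<or> t = 0" using W add_self_eq_0[of "s * t"] by simp
    moreover have "s \<noteq> 0"
    proof
      assume s0: "s = 0"
      have "t * (t * t - 1) = 0" using t by (simp add: power3_eq_cube algebra_simps)
      hence "t = 0 \<or> t = 1 \<or> t = - 1" by (auto simp: square_eq_1_iff)
      hence "h e21 \<in> {0, e12, - e12}" using s0 by (auto simp: r zero_prod_def)
      hence "h e21 \<in> {h 0, h e12, h (- e12)}" using neg[OF cone_frame(2)] by (simp add: h0 h12)
      thus False using inj omega_neq by (auto simp: zero_prod_def)
    qed
    ultimately have t0: "t = 0" by simp
    \<comment> \<open>The third points of the lines through \<open>e11\<close>, \<open>e21\<close>
      and through \<open>e12\<close>, \<open>e22\<close> are adjacent; a sign change of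
      \<open>e21\<close> would make their images non-adjacent.\<close>
    have "s \<noteq> - \<omega>"
    proof
      assume s': "s = - \<omega>"
      have q: "e21 - e11 \<in> cone" "e22 - e12 \<in> cone"
        using omega_neq by (simp_all add: cone_def zero_prod_def)
      have 1: "h (- e11 - e21) = (- 1 + \<omega>, 0)"
        using Aut9_isotropic_line[OF h q(1)] by (simp add: h11 r s' t0)
      have 2: "h (- e12 - e22) = - e12 - e22"
        using Aut9_isotropic_line[OF h q(2)] by (simp only: h12 h22)
      have "1 + \<omega> \<noteq> 0" "- 1 + \<omega> \<noteq> 0"
        using omega_neq(2,3) eq_neg_iff_add_eq_0[of \<omega> 1] eq_neg_iff_add_eq_0[of \<omega> "- 1"]
        by (simp_all only: minus_minus add.commute[of _ \<omega>] simp_thms)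
      note nz = this
      have d: "(- e11 - e21) - (- e12 - e22) = (- (1 + \<omega>), 1 + \<omega>)" by simp
      have "(- e11 - e21) - (- e12 - e22) \<in> cone"
        unfolding d cone_def mem_Collect_eq fst_conv snd_conv zero_prod_def prod.inject using nz(1) by blast
      hence "h (- e11 - e21) - h (- e12 - e22) \<in> cone" using diff_preserving_iff[OF h] by blast
      moreover have "h (- e11 - e21) - h (- e12 - e22) = (- 1 + \<omega>, 1 + \<omega>)" unfolding 1 2 by simp
      moreover have "(- 1 + \<omega>, 1 + \<omega>) \<notin> cone"
      proof -
        have "- 1 + \<omega> \<noteq> 1 + \<omega>" "- 1 + \<omega> \<noteq> - (1 + \<omega>)"
          using char3(7) omega_neq(8) by (simp_all only: add_right_cancel add_left_cancel minus_add_distrib simp_thms)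
        thus ?thesis unfolding cone_def mem_Collect_eq fst_conv snd_conv using nz by blast
      qed
      ultimately show False by simp
    qed
    moreover have "s \<in> {0, \<omega>, - \<omega>}" using s by (simp only: anti_fixed_iff)
    ultimately have "s = \<omega>" using \<open>s \<noteq> 0\<close> by blast
    thus ?thesis by (simp add: r t0)
  qed
  have frame: "h e = e" "wronski e = 0" "h (- e) = - e" if "e \<in> {e11, e12, e21, e22}" for e
    using that by (elim insertE emptyE; simp only: h11 h12 h21 h22 neg cone_frame wronski_frame)+
  have fix_anisotropic: "h y = y" if y: "wronski y \<noteq> 0" for y
  proof -
    define v where "v = wronski y"
    define v' where "v' = wronski (h y)"
    have v: "v \<in> {\<omega>, - \<omega>}" "v' \<in> {\<omega>, - \<omega>}"
      using y W0[of y] wronski_anti_fixed[of y, unfolded anti_fixed_iff] wronski_anti_fixed[of "h y", unfolded anti_fixed_iff]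
      by (auto simp: v_def v'_def)
    have dich: "v' = v \<and> wbil (h y) e = wbil y e \<or> v' = - v \<and> wbil (h y) e = - wbil y e"
      if e: "e \<in> {e11, e12, e21, e22}" for e
    proof (rule sign_dichotomy[OF v])
      show "wbil y e \<in> {0, \<omega>, - \<omega>}" "wbil (h y) e \<in> {0, \<omega>, - \<omega>}"
        using wbil_anti_fixed anti_fixed_iff by blast+
      show "v = wbil y e \<longleftrightarrow> v' = wbil (h y) e"
        using Aut9_wronski[OF h, of y e] unfolding frame[OF e] wronski_diff v_def v'_def by auto
      show "v = - wbil y e \<longleftrightarrow> v' = - wbil (h y) e"
        using Aut9_wronski[OF h, of y "- e"] unfolding frame[OF e] wronski_diff wronski_uminus wbil_uminus v_def v'_def
        by (auto simp: eq_neg_iff_add_eq_0)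
    qed
    show ?thesis
    proof (cases "v' = v")
      case True
      have "v \<noteq> - v" using v omega_neq by auto
      hence "wbil (h y) e = wbil y e" if "e \<in> {e11, e12, e21, e22}" for e using dich[OF that] True by auto
      thus ?thesis by (rule wbil_frame_eqD)
    next
      case False
      hence "wbil (h y) e = wbil (- y) e" if "e \<in> {e11, e12, e21, e22}" for e
        using dich[OF that] by (auto simp: wbil_def cube_uminus)
      \<comment> \<open>The opposite sign refutes itself: \<open>wronski\<close> is even, so it
        would take the same value at \<open>y\<close> and at \<open>h y\<close>.\<close>
      hence "h y = - y" by (rule wbil_frame_eqD)
      hence "v' = v" by (simp add: v_def v'_def wronski_uminus)
      thus ?thesis using False by simp
    qed
  qed
  have "h y = y" for y
  proof (cases "wronski y = 0")
    case True
    hence W: "wronski (h y) = 0" using W0 by simp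
    have eq: "wbil (h y) w = wbil y w" if w: "wronski w \<noteq> 0" for w
    proof -
      have "wronski w \<in> {\<omega>, - \<omega>}"
        using w wronski_anti_fixed[of w, unfolded anti_fixed_iff] by auto
      moreover have "wbil y w \<in> {0, \<omega>, - \<omega>}" "wbil (h y) w \<in> {0, \<omega>, - \<omega>}"
        using wbil_anti_fixed anti_fixed_iff by blast+
      moreover have hw: "h w = w" "h (- w) = - w"
        using fix_anisotropic[of w] fix_anisotropic[of "- w"] w wronski_uminus[of w] by simp_all
      moreover have "wronski w = wbil y w \<longleftrightarrow> wronski w = wbil (h y) w"
        "wronski w = - wbil y w \<longleftrightarrow> wronski w = - wbil (h y) w"
        using Aut9_wronski[OF h, of y w] Aut9_wronski[OF h, of y "- w"]
        unfolding hw wronski_diff wronski_uminus wbil_uminus True W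
        by (simp_all only: add_0_left right_minus_eq diff_minus_eq_add eq_neg_iff_add_eq_0)
      moreover have "wronski w \<noteq> - wronski w"
        using w by (simp only: neg_self_iff) simp
      ultimately show ?thesis using sign_dichotomy[of "wronski w" "wronski w" "wbil y w" "wbil (h y) w"] by blast
    qed
    \<comment> \<open>The frame itself is isotropic, so its polar values are recovered from
      anisotropic sums and differences.\<close>
    have "wronski (e11 + e22) \<noteq> 0" "wronski (e11 - e22) \<noteq> 0" "wronski (e21 + e12) \<noteq> 0" "wronski (e21 - e12) \<noteq> 0"
      using two_neq_0 by (simp_all add: omega_neq(1) wronski_def cube_omega cube_uminus)
    note eqs = this[THEN eq, unfolded wbil_add wbil_diff]
    have half: "a = c \<and> b = d" if "a + b = c + d" "a - b = c - d" for a b c d :: 'a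
    proof -
      have "(a - c) + (a - c) = ((a + b) - (c + d)) + ((a - b) - (c - d))" by simp
      also have "\<dots> = 0" using that by simp
      finally have "a = c" by (simp only: add_self_eq_0) simp
      thus ?thesis using that by simp
    qed
    have "wbil (h y) e = wbil y e" if "e \<in> {e11, e12, e21, e22}" for e
      using that half[OF eqs(1,2)] half[OF eqs(3,4)] by blast
    thus ?thesis by (rule wbil_frame_eqD)
  next
    case False
    thus ?thesis by (rule fix_anisotropic)
  qed
  thus ?thesis by (simp add: fun_eq_iff del: split_paired_All)
qed

subsection \<open>Counting the images of a frame\<close>

lemma scl_uminus: "scl (- x) k = - scl x k" "scl x (- k) = - scl x k" for x :: 'a
  by (simp_all add: scl_def prod_eq_iff)

lemma scl_directions_eq_0: "k \<in> directions \<Longrightarrow> scl x k = 0 \<longleftrightarrow> x = 0"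
  by (auto simp: directions_def scl_def zero_prod_def)

lemma scl_directions_cone: "k \<in> directions \<Longrightarrow> x \<noteq> 0 \<Longrightarrow> scl x k \<in> cone"
  using scl_in_cone directions_F3 scl_directions_eq_0 by blast

lemma det2_distinct_directions: "k \<in> directions \<Longrightarrow> l \<in> directions \<Longrightarrow> k \<noteq> l \<Longrightarrow> det2 k l \<noteq> 0"
  using two_neq_0 by (auto simp: directions_def det2_def)

text \<open>Two rank one matrices differ by rank at most one exactly when they share one of their
  two factors up to sign.\<close>

lemma wronski_scl_diff:
  assumes k: "k \<in> directions" and m: "m \<in> directions" and x: "x \<noteq> 0" and z: "z \<noteq> 0"
  shows "wronski (scl z m - scl x k) = 0 \<longleftrightarrow> m = k \<or> z \<in> {x, - x}"
proof -
  have K: "k \<in> K \<times> K" "m \<in> K \<times> K" using k m directions_F3 by auto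
  have "wronski (scl z m - scl x k) = (z ^ 3 * (- x) - z * (- x) ^ 3) * det2 m k"
    using wronski_lincomb[OF K(2,1), of z "- x"] by (simp add: scl_uminus)
  also have "z ^ 3 * (- x) - z * (- x) ^ 3 = z * x * ((x - z) * (x + z))"
    by (simp add: power3_eq_cube algebra_simps)
  finally have "wronski (scl z m - scl x k) = 0 \<longleftrightarrow> x - z = 0 \<or> x + z = 0 \<or> det2 m k = 0"
    using x z by simp
  moreover have "det2 m k = 0 \<longleftrightarrow> m = k"
    using det2_distinct_directions[OF m k] det2_self by blast
  moreover have "x - z = 0 \<longleftrightarrow> z = x" "x + z = 0 \<longleftrightarrow> z = - x"
    by (auto simp: add_eq_0_iff)
  ultimately show ?thesis by blast
qed

text \<open>The adjacency pattern of the images of \<open>e11\<close>, \<open>e22\<close>,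
  \<open>e12\<close>, in this order, under an automorphism fixing 0.\<close>

definition frames :: "(('a \<times> 'a) \<times> ('a \<times> 'a) \<times> ('a \<times> 'a)) set" where
  "frames = {(u, v, w). u \<in> cone \<and> v \<in> cone \<and> v \<noteq> u \<and> v - u \<notin> cone \<and>
     w \<in> cone \<and> w - u \<in> cone \<and> w - v \<in> cone}"

definition frame_params :: "('a \<times> ('a \<times> 'a) \<times> 'a \<times> ('a \<times> 'a) \<times> ('a \<times> 'a)) set" where
  "frame_params = (SIGMA x:UNIV - {0}. SIGMA k:directions. SIGMA y:UNIV - {0, x, - x}.
     SIGMA l:directions - {k}. {scl x l, scl (- x) l, scl y k, scl (- y) k})"

lemma frame_params_iff:
  "(x, k, y, l, w) \<in> frame_params \<longleftrightarrow> x \<noteq> 0 \<and> k \<in> directions \<and> y \<notin> {0, x, - x} \<and> l \<in> directions \<and> l \<noteq> k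
    \<and> w \<in> {scl x l, scl (- x) l, scl y k, scl (- y) k}"
  by (auto simp: frame_params_def)

lemma frames_eq_image: "frames = (\<lambda>(x, k, y, l, w). (scl x k, scl y l, w)) ` frame_params"
proof (intro equalityI subsetI)
  fix f assume f: "f \<in> frames"
  obtain u v w where uvw: "f = (u, v, w)" by (cases f)
  from f have u: "u \<in> cone" and v: "v \<in> cone" and w: "w \<in> cone" and vu: "wronski (v - u) \<noteq> 0"
    and wu: "wronski (w - u) = 0" and wv: "wronski (w - v) = 0"
    by (auto simp: frames_def uvw cone_iff_wronski)
  obtain x k where k: "x \<noteq> 0" "k \<in> directions" "u = scl x k" using cone_decompose[OF u] .
  obtain y l where l: "y \<noteq> 0" "l \<in> directions" "v = scl y l" using cone_decompose[OF v] .
  obtain z m where m: "z \<noteq> 0" "m \<in> directions" "w = scl z m" using cone_decompose[OF w] .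
  have 1: "l \<noteq> k" "y \<notin> {x, - x}"
    using vu wronski_scl_diff[OF k(2) l(2) k(1) l(1)] by (simp_all add: k l)
  have 2: "m = k \<or> z \<in> {x, - x}" using wu wronski_scl_diff[OF k(2) m(2) k(1) m(1)] by (simp add: k m)
  have 3: "m = l \<or> z \<in> {y, - y}" using wv wronski_scl_diff[OF l(2) m(2) l(1) m(1)] by (simp add: l m)
  \<comment> \<open>The first two points share no factor, so \<open>w\<close> takes its direction
    from one of them and its scalar, up to sign, from the other.\<close>
  have "w \<in> {scl x l, scl (- x) l, scl y k, scl (- y) k}"
  proof (cases "m = k")
    case True
    thus ?thesis using 1 3 m(3) by auto
  next
    case False
    hence z: "z \<in> {x, - x}" using 2 by blast
    hence "z \<notin> {y, - y}" using 1(2) by auto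
    thus ?thesis using 3 z m(3) by auto
  qed
  hence "(x, k, y, l, w) \<in> frame_params" using 1 k l by (simp add: frame_params_iff)
  thus "f \<in> (\<lambda>(x, k, y, l, w). (scl x k, scl y l, w)) ` frame_params"
    by (rule rev_image_eqI) (simp add: uvw k l)
next
  fix f assume "f \<in> (\<lambda>(x, k, y, l, w). (scl x k, scl y l, w)) ` frame_params"
  then obtain x k y l w where f: "f = (scl x k, scl y l, w)" and p: "(x, k, y, l, w) \<in> frame_params" by auto
  have k: "x \<noteq> 0" "k \<in> directions" and l: "y \<noteq> 0" "l \<in> directions" and lk: "l \<noteq> k" and y: "y \<notin> {x, - x}"
    using p by (auto simp: frame_params_iff)
  obtain z m where m: "w = scl z m" and zm: "(z, m) \<in> {(x, l), (- x, l), (y, k), (- y, k)}"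
    using p unfolding frame_params_iff by blast
  have mz: "z \<noteq> 0" "m \<in> directions" using zm k l by auto
  have "y \<noteq> - x" "- y \<noteq> x" "- y \<noteq> - x" using y by (auto simp: minus_equation_iff[of y])
  hence ne: "scl z m \<noteq> scl x k" "scl z m \<noteq> scl y l"
    using directions_scl_eq[OF mz(2) k(2) mz(1), of x] directions_scl_eq[OF mz(2) l(2) mz(1), of y] zm lk y
    by auto
  have "wronski (scl y l - scl x k) \<noteq> 0"
    using wronski_scl_diff[OF k(2) l(2) k(1) l(1)] lk y by blast
  moreover have "scl y l \<noteq> scl x k" using directions_scl_eq[OF l(2) k(2) l(1), of x] lk by blast
  moreover have "wronski (scl z m - scl x k) = 0" "wronski (scl z m - scl y l) = 0"
    using wronski_scl_diff[OF k(2) mz(2) k(1) mz(1)] wronski_scl_diff[OF l(2) mz(2) l(1) mz(1)] zm by auto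
  moreover have "scl x k \<in> cone" "scl y l \<in> cone" "scl z m \<in> cone"
    using k l mz scl_directions_cone by blast+
  ultimately show "f \<in> frames" using ne by (simp add: f m frames_def cone_iff_wronski)
qed

lemma card_frames: "card frames = 2304"
proof -
  have inj: "inj_on (\<lambda>(x, k, y, l, w). (scl x k, scl y l, w)) frame_params"
  proof (rule inj_onI)
    fix p q assume p: "p \<in> frame_params" and q: "q \<in> frame_params"
      and eq: "(case p of (x, k, y, l, w) \<Rightarrow> (scl x k, scl y l, w)) = (case q of (x, k, y, l, w) \<Rightarrow> (scl x k, scl y l, w))"
    obtain x k y l w where p': "p = (x, k, y, l, w)" by (metis surj_pair)
    obtain x' k' y' l' w' where q': "q = (x', k', y', l', w')" by (metis surj_pair)
    have "x = x' \<and> k = k'" "y = y' \<and> l = l'"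
      using p q eq directions_scl_eq[of k k' x x'] directions_scl_eq[of l l' y y'] by (auto simp: p' q' frame_params_iff)
    thus "p = q" using eq by (simp add: p' q')
  qed
  have four: "card {scl x l, scl (- x) l, scl y k, scl (- y) k} = 4"
    if "x \<noteq> 0" "k \<in> directions" "y \<in> UNIV - {0, x, - x}" "l \<in> directions - {k}" for x y k l
  proof -
    have "x \<noteq> - x" "y \<noteq> - y" using that by (auto simp only: neg_self_iff DiffE insert_iff)
    hence "scl x l \<noteq> scl (- x) l" "scl y k \<noteq> scl (- y) k"
      using that directions_scl_eq[of l l x "- x"] directions_scl_eq[of k k y "- y"] by auto
    moreover have "scl z l \<noteq> scl c k" if "z \<noteq> 0" for z c
      using that directions_scl_eq[of l k z c] \<open>k \<in> directions\<close> \<open>l \<in> directions - {k}\<close> by auto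
    ultimately show ?thesis using that by simp
  qed
  have six: "card (UNIV - {0, x, - x}) = 6" if "x \<noteq> 0" for x :: 'a
  proof -
    have "x \<noteq> - x" using that by (simp only: neg_self_iff) simp
    hence "card {0, x, - x} = 3" using that by simp
    thus ?thesis by (simp add: card_Diff_subset card9 del: Diff_insert)
  qed
  have fin: "finite directions" by (simp add: directions_def)
  have "card frames = card frame_params" unfolding frames_eq_image by (rule card_image[OF inj])
  also have "\<dots> = (\<Sum>x\<in>UNIV - {0}. \<Sum>k\<in>directions. \<Sum>y\<in>UNIV - {0, x, - x}. \<Sum>l\<in>directions - {k}.
      card {scl x l, scl (- x) l, scl y k, scl (- y) k})"
    unfolding frame_params_def using fin by (simp add: card_SigmaI del: card_insert_disjoint Diff_insert)
  also have "\<dots> = (\<Sum>x\<in>UNIV - {0 :: 'a}. \<Sum>k\<in>directions. \<Sum>y\<in>UNIV - {0, x, - x}. \<Sum>l\<in>directions - {k}. 4)"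
    by (intro sum.cong refl four) auto
  also have "\<dots> = (\<Sum>x\<in>UNIV - {0 :: 'a}. \<Sum>k\<in>directions. 6 * (3 * 4))"
  proof (intro sum.cong refl)
    fix x :: 'a and k :: "'a \<times> 'a" assume x: "x \<in> UNIV - {0}" and k: "k \<in> directions"
    have three': "card (directions - {k}) = 3" using k fin by (simp add: card_directions)
    have "x \<noteq> 0" using x by simp
    from six[OF this] show "(\<Sum>y\<in>UNIV - {0, x, - x}. \<Sum>l\<in>directions - {k}. 4) = (6 * (3 * 4) :: nat)"
      by (simp only: sum_constant three') simp
  qed
  also have "\<dots> = 2304" by (simp add: card_directions card9)
  finally show ?thesis .
qed

lemma transposition_frame:
  "transposition e11 = e11" "transposition e22 = e22" "transposition e12 = e21" "transposition 0 = 0"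
proof -
  have "0 \<in> K" "1 \<in> K" by (simp_all add: F3_def)
  note re_im_frame[OF this(1), simp] re_im_frame[OF this(2), simplified, simp]
  show "transposition e11 = e11" "transposition e22 = e22" "transposition e12 = e21" "transposition 0 = 0"
    by (simp_all add: transposition_def zero_prod_def)
qed

text \<open>A tensor map sends \<open>e12\<close> to \<open>scl x l\<close>. Negating both
  \<open>x\<close> and \<open>k\<close> keeps the image of \<open>e11\<close> but negates that of
  \<open>e12\<close>. Precomposing with the transposition replaces \<open>e12\<close> by
  \<open>e21\<close>, which yields the two choices with direction \<open>k\<close>.\<close>

lemma frame_realized:
  assumes "(u, v, w) \<in> frames"
  shows "\<exists>f\<in>Aut9. f 0 = 0 \<and> f e11 = u \<and> f e22 = v \<and> f e12 = w"
proof -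
  obtain x k y l where uv: "u = scl x k" "v = scl y l" and p: "(x, k, y, l, w) \<in> frame_params"
    using assms unfolding frames_eq_image by auto
  have k: "x \<noteq> 0" "k \<in> directions" and l: "l \<in> directions" and lk: "l \<noteq> k" and y: "y \<notin> {0, x, - x}"
    and w: "w \<in> {scl x l, scl (- x) l, scl y k, scl (- y) k}"
    using p unfolding frame_params_iff by blast+
  have K: "k \<in> K \<times> K" "l \<in> K \<times> K" using k l directions_F3 by auto
  hence K': "- k \<in> K \<times> K" using F3_closed(4)[OF three] by (auto simp: mem_Times_iff)
  have d: "det2 k l \<noteq> 0" using det2_distinct_directions k l lk by blast
  hence d': "det2 (- k) l \<noteq> 0" by (simp add: det2_def)
  define f where "f = tensor x y k l"
  define g where "g = tensor (- x) y (- k) l"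
  have f: "f \<in> Aut9" unfolding f_def by (rule tensor_Aut9[OF K d k(1) y])
  have g: "g \<in> Aut9" unfolding g_def by (rule tensor_Aut9[OF K' K(2) d']) (use k(1) y in auto)
  have f0: "f 0 = 0" using tensor_diff[of x y k l 0 0] by (simp add: f_def)
  have g0: "g 0 = 0" using tensor_diff[of "- x" y "- k" l 0 0] by (simp add: g_def)
  note ff = tensor_frame[OF K, of x y, folded f_def]
  note gf = tensor_frame[OF K' K(2), of "- x" y, folded g_def, unfolded scl_uminus minus_minus]
  note tf = transposition_frame
  from w consider "w = scl x l" | "w = scl (- x) l" | "w = scl y k" | "w = scl (- y) k" by blast
  thus ?thesis
  proof cases
    case 1
    thus ?thesis using f f0 ff by (intro bexI[of _ f]) (simp_all add: uv)
  next
    case 2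
    thus ?thesis using g g0 gf by (intro bexI[of _ g]) (simp_all add: uv scl_uminus)
  next
    case 3
    thus ?thesis using diff_preserving_comp[OF f transposition_Aut9] f0 ff
      by (intro bexI[of _ "f \<circ> transposition"]) (simp_all add: uv tf)
  next
    case 4
    thus ?thesis using diff_preserving_comp[OF g transposition_Aut9] g0 gf
      by (intro bexI[of _ "g \<circ> transposition"]) (simp_all add: uv scl_uminus tf)
  qed
qed

text \<open>Automorphisms with equal frame data differ by one that fixes 0 and the three matrix
  units, which is the identity by rigidity. Every admissible frame is realised up to translation, so
  the count is 81 * 2304.\<close>

lemma card_Aut9: "card Aut9 = 186624"
proof -
  let ?\<Phi> = "\<lambda>f :: 'a \<times> 'a \<Rightarrow> 'a \<times> 'a. (f 0, f e11 - f 0, f e22 - f 0, f e12 - f 0)"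
  have "bij_betw ?\<Phi> Aut9 (UNIV \<times> frames)"
    unfolding bij_betw_def
  proof
    show "inj_on ?\<Phi> Aut9"
    proof (rule inj_onI)
      fix f g assume f: "f \<in> Aut9" and g: "g \<in> Aut9" and eq: "?\<Phi> f = ?\<Phi> g"
      have "f 0 = g 0 \<and> f e11 - f 0 = g e11 - g 0 \<and> f e22 - f 0 = g e22 - g 0 \<and> f e12 - f 0 = g e12 - g 0"
        using eq unfolding prod.inject .
      hence e: "f 0 = g 0" "f e11 = g e11" "f e22 = g e22" "f e12 = g e12"
        by (metis diff_add_cancel)+
      have bij: "bij g" using g by (simp add: diff_preserving_def)
      have "inv_into UNIV g \<circ> f = id"
        by (rule Aut9_rigid[OF diff_preserving_comp[OF diff_preserving_inv[OF g] f]])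
           (simp_all add: e bij_is_inj[OF bij])
      hence "g \<circ> (inv_into UNIV g \<circ> f) = g" by simp
      moreover have "g \<circ> inv_into UNIV g = id" by (rule surj_iff[THEN iffD1, OF bij_is_surj[OF bij]])
      ultimately show "f = g" by (simp flip: comp_assoc)
    qed
  next
    show "?\<Phi> ` Aut9 = UNIV \<times> frames"
    proof (intro equalityI subsetI)
      fix p assume "p \<in> ?\<Phi> ` Aut9"
      then obtain f where f: "f \<in> Aut9" "p = ?\<Phi> f" by blast
      have inj: "f z = f w \<longleftrightarrow> z = w" for z w using f(1) by (auto simp: diff_preserving_def bij_is_inj inj_eq)
      have "e11 - 0 \<in> cone" "e22 - 0 \<in> cone" "e12 - 0 \<in> cone" "e12 - e11 \<in> cone" "e12 - e22 \<in> cone"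
        "e22 - e11 \<notin> cone" "e22 \<noteq> e11"
        using omega_neq by (simp_all add: cone_def zero_prod_def)
      thus "p \<in> UNIV \<times> frames"
        unfolding f(2) frames_def by (simp add: diff_preserving_iff[OF f(1)] inj)
    next
      fix p :: "('a \<times> 'a) \<times> ('a \<times> 'a) \<times> ('a \<times> 'a) \<times> 'a \<times> 'a" assume p: "p \<in> UNIV \<times> frames"
      obtain c u v w where c: "p = (c, u, v, w)" by (metis surj_pair)
      obtain f where f: "f \<in> Aut9" "f 0 = 0" "f e11 = u" "f e22 = v" "f e12 = w"
        using frame_realized[of u v w] p by (auto simp: c)
      have "bij ((\<lambda>z. z + c) \<circ> f)" using f(1) by (simp add: bij_comp bij_plus_right diff_preserving_def)
      hence "(\<lambda>z. z + c) \<circ> f \<in> Aut9"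
        using f(1) unfolding diff_preserving_def by (simp del: split_paired_All)
      moreover have "p = ?\<Phi> ((\<lambda>z. z + c) \<circ> f)" by (simp add: c f)
      ultimately show "p \<in> ?\<Phi> ` Aut9" by blast
    qed
  qed
  hence "card Aut9 = card ((UNIV :: ('a \<times> 'a) set) \<times> frames)" by (rule bij_betw_same_card)
  thus ?thesis by (simp add: card_cartesian_product card_frames card9)
qed

theorem card_Aut_set_GF9: "card (Aut_set :: ('a \<times> 'a \<Rightarrow> 'a \<times> 'a) set) = 186624"
  using card_Aut_set[OF frame_det cone_gnorm] card_Aut9 by simp

end

theorem theorem3:
  shows "(CARD('a::{field,finite}) = 5 \<longrightarrow>
            group_index (AffAut_group :: ('a \<times> 'a \<Rightarrow> 'a \<times> 'a) monoid) G_set = 2 \<and>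
            Coset.order (AffAut_group :: ('a \<times> 'a \<Rightarrow> 'a \<times> 'a) monoid) = 800 \<and>
            Coset.order (Aut_group :: ('a \<times> 'a \<Rightarrow> 'a \<times> 'a) monoid) = 28800) \<and>
         (CARD('a) = 9 \<longrightarrow>
            group_index (AffAut_group :: ('a \<times> 'a \<Rightarrow> 'a \<times> 'a) monoid) G_set = 3 \<and>
            Coset.order (AffAut_group :: ('a \<times> 'a \<Rightarrow> 'a \<times> 'a) monoid) = 31104 \<and>
            Coset.order (Aut_group :: ('a \<times> 'a \<Rightarrow> 'a \<times> 'a) monoid) = 186624)"
proof -
  have order: "Coset.order (AffAut_group :: ('a \<times> 'a \<Rightarrow> 'a \<times> 'a) monoid) = card (AffAut_set :: ('a \<times> 'a \<Rightarrow> 'a \<times> 'a) set)"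
    "Coset.order (Aut_group :: ('a \<times> 'a \<Rightarrow> 'a \<times> 'a) monoid) = card (Aut_set :: ('a \<times> 'a \<Rightarrow> 'a \<times> 'a) set)"
    by (simp_all add: Coset.order_def AffAut_group_def Aut_group_def)
  show ?thesis
    unfolding order
  proof (intro conjI impI)
    assume card: "CARD('a) = 5"
    show "group_index (AffAut_group :: ('a \<times> 'a \<Rightarrow> 'a \<times> 'a) monoid) G_set = 2"
      "card (AffAut_set :: ('a \<times> 'a \<Rightarrow> 'a \<times> 'a) set) = 800"
      "card (Aut_set :: ('a \<times> 'a \<Rightarrow> 'a \<times> 'a) set) = 28800"
      using automorphism_groups_GF5[OF card] by simp_all
  next
    assume "CARD('a) = 9"
    then obtain \<omega> :: 'a where "GF9 \<omega>" using GF9_exists by blast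
    then interpret GF9 \<omega> .
    show "group_index (AffAut_group :: ('a \<times> 'a \<Rightarrow> 'a \<times> 'a) monoid) G_set = 3"
      "card (AffAut_set :: ('a \<times> 'a \<Rightarrow> 'a \<times> 'a) set) = 31104"
      "card (Aut_set :: ('a \<times> 'a \<Rightarrow> 'a \<times> 'a) set) = 186624"
      using affine_automorphism_groups_GF9 card_Aut_set_GF9 by simp_all
  qed
qed

end
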